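(* Let $G$ be a finite group and $p$ a fixed prime divisor of $|G|$. Then every self-centralizing subgroup of $G$ is a TI-subgroup of $G$ or subnormal in $G$ or has $p'$-order if and only if every subgroup of $G$ is a TI-subgroup of $G$ or subnormal in $G$ or has $p'$-order.
   Context: All groups are finite. A subgroup $H$ of a group $G$ is a TI-subgroup of $G$ if for every $g\in G$, $H^g\cap H=1$ or $H^g\cap H=H$. A subgroup $H$ of $G$ is self-centralizing in $G$ if $C_G(H)\leq H$. A subgroup has $p'$-order if its order is not divisible by $p$. *)

theory Defs
  imports "HOL-Algebra.Algebra"
begin

definition conj_set :: "('a, 'b) monoid_scheme \<Rightarrow> 'a set \<Rightarrow> 'a \<Rightarrow> 'a set" where
  "conj_set G H g = (\<lambda>h. inv\<^bsub>G\<^esub> g \<otimes>\<^bsub>G\<^esub> h \<otimes>\<^bsub>G\<^esub> g) ` H"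

definition TI_subgroup :: "'a set \<Rightarrow> ('a, 'b) monoid_scheme \<Rightarrow> bool" where
  "TI_subgroup H G \<longleftrightarrow> subgroup H G \<and>
     (\<forall>g\<in>carrier G. conj_set G H g \<inter> H = {\<one>\<^bsub>G\<^esub>} \<or> conj_set G H g \<inter> H = H)"

definition centralizer :: "('a, 'b) monoid_scheme \<Rightarrow> 'a set \<Rightarrow> 'a set" where
  "centralizer G H = {g \<in> carrier G. \<forall>h\<in>H. g \<otimes>\<^bsub>G\<^esub> h = h \<otimes>\<^bsub>G\<^esub> g}"

definition self_centralizing :: "'a set \<Rightarrow> ('a, 'b) monoid_scheme \<Rightarrow> bool" where
  "self_centralizing H G \<longleftrightarrow> subgroup H G \<and> centralizer G H \<subseteq> H"

inductive subnormal :: "'a set \<Rightarrow> ('a, 'b) monoid_scheme \<Rightarrow> bool" where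
  top: "subnormal (carrier G) G"
| step: "\<lbrakk> subnormal K G; subgroup H G; H \<subseteq> K; normal H (G\<lparr>carrier := K\<rparr>) \<rbrakk>
          \<Longrightarrow> subnormal H G"

end

theory Submission
  imports Defs
begin

text \<open>
  Let \<open>H\<close> be a maximal counterexample to the nontrivial direction, \<open>g\<close> a witness that it is not TI,
  and \<open>c\<close> an element of prime power order of its centralizer with \<open>c \<notin> H\<close> and \<open>c\<^sup>q \<in> H\<close>. By maximality
  \<open>L = H\<langle>c\<rangle>\<close> and \<open>F = N\<^sub>G(L)\<close> are TI, and \<open>F\<close> turns out to be self-normalizing; that is, \<open>G\<close> is a
  Frobenius group with complement \<open>F\<close>. No nontrivial subgroup of \<open>F\<close> is subnormal in \<open>G\<close>, so every
  self-centralizing subgroup of \<open>F\<close> of order divisible by \<open>p\<close> is TI, and it is normal in \<open>F\<close> as soon as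
  it contains a nontrivial normal subgroup of \<open>F\<close>. Applied to centralizers this makes \<open>F\<close> soluble.
  Transfer along the derived series of \<open>F\<close> and the Frattini argument then show that \<open>|F|\<close> divides
  \<open>|N\<^sub>G(R)|\<close> for a Sylow subgroup \<open>R\<close> of order coprime to \<open>|F|\<close>, so that every \<open>q\<close>-subgroup of \<open>F\<close> acts
  without fixed points on a conjugate of \<open>R\<close>. Hence \<open>F\<close> has no elementary abelian subgroup of order
  \<open>q\<^sup>2\<close>, and of two commuting \<open>q\<close>-elements of \<open>F\<close> one is a power of the other. Since \<open>c\<close> and its
  conjugate by \<open>g\<close> are central in \<open>L\<close>, this forces \<open>g\<close> to normalize \<open>H\<close>.
\<close>

text \<open>The obstacle is the Frobenius kernel: its existence in general rests on character
  theory, and it is never constructed here. One consequence suffices, namely a nontrivial Sylow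
  subgroup \<open>R\<close> of order prime to \<open>|F|\<close> whose normalizer contains a
  conjugate of a given \<open>q\<close>-subgroup of \<open>F\<close>. Transfer yields it for soluble
  \<open>F\<close>, which is why solubility has to come before any statement about
  \<open>q\<close>-subgroups. The \<open>q\<close>-subgroup can be moved into the normalizer of
  \<open>R\<close> because the index of that normalizer divides \<open>|G:F|\<close>, and
  \<open>|G:F|\<close> is congruent to 1 modulo every prime divisor of \<open>|F|\<close>. The prime
  \<open>q\<close> comes from \<open>c\<close> and is unrelated to \<open>p\<close>. Inside
  \<open>F\<close> the prime \<open>p\<close> acts through an element \<open>x\<close> of order
  \<open>p\<close>: every subgroup containing \<open>x\<close> has order divisible by
  \<open>p\<close>, so the hypothesis speaks about it as soon as it is self-centralizing. Unlike a
  Frobenius complement, a malnormal subgroup may be trivial or all of \<open>G\<close>; the descent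
  along the derived series ends at the trivial one.\<close>

definition malnormal :: "'a set \<Rightarrow> ('a, 'b) monoid_scheme \<Rightarrow> bool" where
  "malnormal F G \<longleftrightarrow> subgroup F G \<and>
     (\<forall>g\<in>carrier G. \<forall>f\<in>F. f \<noteq> \<one>\<^bsub>G\<^esub> \<longrightarrow> inv\<^bsub>G\<^esub> g \<otimes>\<^bsub>G\<^esub> f \<otimes>\<^bsub>G\<^esub> g \<in> F \<longrightarrow> g \<in> F)"

section \<open>Conjugation, normalizers and the TI condition for single elements\<close>

context group
begin

definition conj_by :: "'a \<Rightarrow> 'a \<Rightarrow> 'a" where
  "conj_by g h = inv g \<otimes> h \<otimes> g"

lemma inv_mult_cancel [simp]:
  assumes "x \<in> carrier G" "y \<in> carrier G"
  shows "inv x \<otimes> (x \<otimes> y) = y" "x \<otimes> (inv x \<otimes> y) = y"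
  using assms by (simp_all flip: m_assoc)

lemma conj_by_closed [simp]:
  "g \<in> carrier G \<Longrightarrow> h \<in> carrier G \<Longrightarrow> conj_by g h \<in> carrier G"
  by (simp add: conj_by_def)

lemma conj_by_one [simp]: "g \<in> carrier G \<Longrightarrow> conj_by g \<one> = \<one>"
  by (simp add: conj_by_def)

lemma one_conj_by [simp]: "h \<in> carrier G \<Longrightarrow> conj_by \<one> h = h"
  by (simp add: conj_by_def)

lemma conj_by_mult:
  "\<lbrakk>g \<in> carrier G; h \<in> carrier G; k \<in> carrier G\<rbrakk> \<Longrightarrow> conj_by g (h \<otimes> k) = conj_by g h \<otimes> conj_by g k"
  by (simp add: conj_by_def m_assoc)

lemma mult_conj_by:
  "\<lbrakk>g \<in> carrier G; h \<in> carrier G; k \<in> carrier G\<rbrakk> \<Longrightarrow> conj_by (g \<otimes> k) h = conj_by k (conj_by g h)"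
  by (simp add: conj_by_def m_assoc inv_mult_group)

lemma conj_by_inv:
  "\<lbrakk>g \<in> carrier G; h \<in> carrier G\<rbrakk> \<Longrightarrow> conj_by g (inv h) = inv (conj_by g h)"
  by (simp add: conj_by_def m_assoc inv_mult_group)

lemma conj_by_cancel [simp]:
  assumes "g \<in> carrier G" "h \<in> carrier G"
  shows "conj_by g (conj_by (inv g) h) = h" "conj_by (inv g) (conj_by g h) = h"
  using assms by (simp_all add: conj_by_def m_assoc)

lemma conj_by_eq_iff [simp]:
  assumes "g \<in> carrier G" "h \<in> carrier G" "k \<in> carrier G"
  shows "conj_by g h = conj_by g k \<longleftrightarrow> h = k"
  using assms by (metis conj_by_cancel(2))

lemma conj_by_eq_one_iff [simp]:
  assumes "g \<in> carrier G" "h \<in> carrier G"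
  shows "conj_by g h = \<one> \<longleftrightarrow> h = \<one>"
  using assms by (metis conj_by_eq_iff conj_by_one one_closed)

lemma conj_by_pow:
  "\<lbrakk>g \<in> carrier G; h \<in> carrier G\<rbrakk> \<Longrightarrow> conj_by g (h [^] (n::nat)) = conj_by g h [^] n"
  by (induction n) (simp_all add: conj_by_mult)

lemma conj_by_fixed_iff:
  assumes "g \<in> carrier G" "h \<in> carrier G"
  shows "conj_by g h = h \<longleftrightarrow> g \<otimes> h = h \<otimes> g"
  using assms by (metis conj_by_def inv_solve_left' m_closed inv_closed m_assoc)

lemma subgroup_conj_by:
  "\<lbrakk>subgroup H G; g \<in> H; h \<in> H\<rbrakk> \<Longrightarrow> conj_by g h \<in> H"
  by (simp add: conj_by_def subgroup.m_closed subgroup.m_inv_closed)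

lemma commute_inv:
  assumes "a \<in> carrier G" "b \<in> carrier G" "a \<otimes> b = b \<otimes> a"
  shows "inv a \<otimes> b = b \<otimes> inv a"
proof -
  have "inv a \<otimes> b = inv a \<otimes> (b \<otimes> a) \<otimes> inv a"
    using assms(1,2) by (simp add: m_assoc)
  also have "\<dots> = b \<otimes> inv a"
    unfolding assms(3)[symmetric] using assms(1,2) by (simp add: m_assoc)
  finally show ?thesis .
qed

lemma subgroup_nat_pow_closed:
  "\<lbrakk>subgroup H G; h \<in> H\<rbrakk> \<Longrightarrow> h [^] (n::nat) \<in> H"
  by (induction n) (auto simp: subgroup.one_closed subgroup.m_closed)

lemma conj_set_eq: "conj_set G H g = conj_by g ` H"
  by (simp add: conj_set_def conj_by_def)

lemma malnormal_iff:
  "malnormal F G \<longleftrightarrow> subgroup F G \<and>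
     (\<forall>g\<in>carrier G. \<forall>f\<in>F. f \<noteq> \<one> \<longrightarrow> conj_by g f \<in> F \<longrightarrow> g \<in> F)"
  by (simp add: malnormal_def conj_by_def)

lemma mem_conj_set_iff:
  assumes "g \<in> carrier G" "H \<subseteq> carrier G" "x \<in> carrier G"
  shows "x \<in> conj_set G H g \<longleftrightarrow> conj_by (inv g) x \<in> H"
  using assms by (auto simp: conj_set_eq image_iff subset_iff) (metis conj_by_cancel(1))

lemma subgroup_conj_set:
  assumes "subgroup H G" "g \<in> carrier G"
  shows "subgroup (conj_set G H g) G"
proof -
  interpret H: subgroup H G by fact
  show ?thesis
  proof (rule subgroupI)
    show "conj_set G H g \<subseteq> carrier G"
      using assms(2) by (auto simp: conj_set_eq)
    show "conj_set G H g \<noteq> {}"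
      using H.one_closed unfolding conj_set_eq by blast
  qed (use assms(2) in \<open>auto simp: conj_set_eq simp flip: conj_by_inv conj_by_mult\<close>)
qed

lemma card_conj_set:
  assumes "H \<subseteq> carrier G" "g \<in> carrier G"
  shows "card (conj_set G H g) = card H"
  unfolding conj_set_eq
  by (rule card_image, rule inj_onI) (use assms in \<open>auto simp: subset_iff\<close>)

lemma conj_set_eqI:
  assumes "finite H" "H \<subseteq> carrier G" "g \<in> carrier G" "\<And>h. h \<in> H \<Longrightarrow> conj_by g h \<in> H"
  shows "conj_set G H g = H"
  using assms by (intro card_subset_eq) (auto simp: card_conj_set, auto simp: conj_set_eq)

lemma conj_by_mem_iff:
  assumes "H \<subseteq> carrier G" "g \<in> carrier G" "h \<in> carrier G" "conj_set G H g = H"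
  shows "conj_by g h \<in> H \<longleftrightarrow> h \<in> H"
  using assms mem_conj_set_iff[of g H "conj_by g h"] by simp

text \<open>\<open>normalizer\<close> stabilizes under \<open>g <# H #> inv g\<close>, whereas
  \<open>conj_set\<close> conjugates from the other side; the two stabilizers agree since
  conjugations by \<open>g\<close> and \<open>inv g\<close> undo each other.\<close>

lemma mem_normalizer_iff:
  assumes "H \<subseteq> carrier G"
  shows "g \<in> normalizer G H \<longleftrightarrow> g \<in> carrier G \<and> conj_set G H g = H"
proof -
  have "g <# H #> inv g = H \<longleftrightarrow> conj_set G H g = H" if g: "g \<in> carrier G"
  proof -
    have "g <# H #> inv g = conj_by (inv g) ` H"
      using g by (auto simp: l_coset_def r_coset_def conj_by_def image_iff)
    moreover have "conj_by g ` conj_by (inv g) ` H = H" "conj_by (inv g) ` conj_by g ` H = H"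
      using g assms by (force simp: image_image subset_iff)+
    ultimately show ?thesis
      by (metis conj_set_eq)
  qed
  then show ?thesis
    using assms by (auto simp: normalizer_def stabilizer_def)
qed

lemma mem_normalizerI:
  assumes "finite H" "H \<subseteq> carrier G" "g \<in> carrier G" "\<And>h. h \<in> H \<Longrightarrow> conj_by g h \<in> H"
  shows "g \<in> normalizer G H"
  using assms by (simp add: mem_normalizer_iff conj_set_eqI)

lemma conj_by_normalizer_mem_iff:
  assumes "H \<subseteq> carrier G" "g \<in> normalizer G H" "h \<in> carrier G"
  shows "conj_by g h \<in> H \<longleftrightarrow> h \<in> H"
  using assms by (simp add: mem_normalizer_iff conj_by_mem_iff)

lemma subgroup_subset_normalizer:
  assumes "subgroup H G" "finite H"
  shows "H \<subseteq> normalizer G H"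
  using assms subgroup.subset by (blast intro: mem_normalizerI subgroup_conj_by)

text \<open>Conjugates of a finite subgroup have equal order, so containing \<open>H\<close> already
  means being equal to \<open>H\<close>. Hence TI can be used through a single nontrivial element
  whose conjugate stays in \<open>H\<close>.\<close>

lemma TI_subgroupD:
  assumes "TI_subgroup H G" "g \<in> carrier G" "h \<in> H" "h \<noteq> \<one>" "conj_by g h \<in> H" "finite H"
  shows "g \<in> normalizer G H"
proof -
  have sub: "H \<subseteq> carrier G"
    using assms(1) by (simp add: TI_subgroup_def subgroup.subset)
  have "conj_by g h \<in> conj_set G H g \<inter> H" "conj_by g h \<noteq> \<one>"
    using assms sub by (auto simp: conj_set_eq)
  then have "conj_set G H g \<inter> H = H"
    using assms(1,2) by (auto simp: TI_subgroup_def)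
  then have "H = conj_set G H g"
    using assms(2,6) sub by (intro card_subset_eq) (auto simp: card_conj_set, auto simp: conj_set_eq)
  then show ?thesis
    using assms(2) sub by (simp add: mem_normalizer_iff)
qed

lemma TI_subgroupI:
  assumes "subgroup H G"
    and "\<And>g h. \<lbrakk>g \<in> carrier G; h \<in> H; h \<noteq> \<one>; conj_by g h \<in> H\<rbrakk> \<Longrightarrow> g \<in> normalizer G H"
  shows "TI_subgroup H G"
  unfolding TI_subgroup_def
proof (intro conjI ballI assms(1))
  fix g assume g: "g \<in> carrier G"
  note sub = subgroup.subset[OF assms(1)]
  show "conj_set G H g \<inter> H = {\<one>} \<or> conj_set G H g \<inter> H = H"
  proof (cases "\<exists>h\<in>H. h \<noteq> \<one> \<and> conj_by g h \<in> H")
    case True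
    then show ?thesis
      using assms(2) g sub by (auto simp: mem_normalizer_iff)
  next
    case False
    have "\<one> \<in> conj_set G H g \<inter> H"
      using assms(1) g by (simp add: subgroup.one_closed subgroup_conj_set)
    moreover have "x = \<one>" if "x \<in> conj_set G H g \<inter> H" for x
      using that False g by (auto simp: conj_set_eq)
    ultimately show ?thesis
      by blast
  qed
qed

end

subsection \<open>Fixed points of $p$-groups\<close>

lemma (in group) group_actionI:
  assumes closed: "\<And>g x. \<lbrakk>g \<in> carrier G; x \<in> E\<rbrakk> \<Longrightarrow> act g x \<in> E"
    and one: "\<And>x. x \<in> E \<Longrightarrow> act \<one> x = x"
    and mult: "\<And>g h x. \<lbrakk>g \<in> carrier G; h \<in> carrier G; x \<in> E\<rbrakk> \<Longrightarrow> act (g \<otimes> h) x = act g (act h x)"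
  shows "group_action G E (\<lambda>g. \<lambda>x\<in>E. act g x)"
proof -
  have Bij: "(\<lambda>x\<in>E. act g x) \<in> Bij E" if g: "g \<in> carrier G" for g
  proof -
    have "bij_betw (act g) E E"
    proof (rule bij_betw_byWitness[where f' = "act (inv g)"])
      show "\<forall>a\<in>E. act (inv g) (act g a) = a"
        using g by (metis inv_closed l_inv mult one)
      show "\<forall>a\<in>E. act g (act (inv g) a) = a"
        using g by (metis inv_closed r_inv mult one)
    qed (use g closed in auto)
    then have "bij_betw (\<lambda>x\<in>E. act g x) E E"
      by (simp cong: bij_betw_cong)
    then show ?thesis
      by (simp add: Bij_def)
  qed
  have "(\<lambda>g. \<lambda>x\<in>E. act g x) \<in> hom G (BijGroup E)"
  proof (rule homI)
    fix g h assume "g \<in> carrier G" "h \<in> carrier G"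
    then show "(\<lambda>x\<in>E. act (g \<otimes> h) x) = (\<lambda>x\<in>E. act g x) \<otimes>\<^bsub>BijGroup E\<^esub> (\<lambda>x\<in>E. act h x)"
      using Bij by (auto simp: BijGroup_def compose_def mult closed fun_eq_iff)
  qed (use Bij in \<open>simp add: BijGroup_def\<close>)
  then show ?thesis
    by (simp add: group_action_def group_hom_def group_hom_axioms_def group_BijGroup is_group)
qed

text \<open>Orbit sizes divide \<open>q ^ k\<close>, so each orbit that is not a fixed point has
  size divisible by \<open>q\<close>, and these orbits partition the rest of
  \<open>E\<close>.\<close>

lemma (in group_action) p_group_fixed_points:
  assumes "Factorial_Ring.prime q" "order G = q ^ k" "finite E"
  shows "card {x\<in>E. \<forall>g\<in>carrier G. \<phi> g x = x} mod q = card E mod q"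
proof -
  define Fix where "Fix = {x\<in>E. \<forall>g\<in>carrier G. \<phi> g x = x}"
  define O' where "O' = {orb \<in> orbits G E \<phi>. orb \<inter> Fix = {}}"
  have fixed_orbit: "orbit G \<phi> x = {x}" if "x \<in> Fix" for x
    using that orbit_refl[of x] by (auto simp: Fix_def orbit_def)
  have "\<Union> O' = E - Fix"
  proof (intro equalityI subsetI)
    fix x assume x: "x \<in> E - Fix"
    have "orbit G \<phi> x \<inter> Fix = {}"
    proof (rule ccontr)
      assume "orbit G \<phi> x \<inter> Fix \<noteq> {}"
      then obtain y where y: "y \<in> orbit G \<phi> x" "y \<in> Fix" by blast
      then have "x \<in> orbit G \<phi> y"
        using x orbit_sym by (auto simp: Fix_def)
      then show False
        using fixed_orbit[OF y(2)] x y(2) by auto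
    qed
    then show "x \<in> \<Union> O'"
      using x orbit_refl[of x] by (auto simp: O'_def orbits_def)
  next
    fix x assume "x \<in> \<Union> O'"
    then show "x \<in> E - Fix"
      using orbits_coverture by (auto simp: O'_def)
  qed
  moreover have "q dvd card (\<Union> O')"
  proof (rule dvd_partition)
    show "finite (\<Union> O')"
      using \<open>\<Union> O' = E - Fix\<close> assms(3) by simp
    show "\<forall>c1\<in>O'. \<forall>c2\<in>O'. c1 \<noteq> c2 \<longrightarrow> c1 \<inter> c2 = {}"
      using disjoint_union by (auto simp: O'_def)
    show "\<forall>c\<in>O'. q dvd card c"
    proof
      fix c assume c: "c \<in> O'"
      then obtain x where x: "x \<in> E" "c = orbit G \<phi> x" "c \<inter> Fix = {}"
        by (auto simp: O'_def orbits_def)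
      have "card c dvd q ^ k"
        using orbit_stabilizer_theorem[OF x(1)] assms(2) x(2) by (metis dvd_triv_left)
      then obtain j where j: "card c = q ^ j"
        using assms(1) divides_primepow_nat by blast
      have "j \<noteq> 0"
      proof
        assume "j = 0"
        then obtain z where z: "c = {z}"
          using j by (auto simp: card_1_singleton_iff)
        then have "c = {x}"
          using orbit_refl[OF x(1)] x(2) by auto
        then have "x \<in> Fix"
          using x by (auto simp: Fix_def orbit_def)
        then show False
          using x orbit_refl[OF x(1)] by auto
      qed
      then show "q dvd card c"
        using j by simp
    qed
  qed
  moreover have "card E = card Fix + card (E - Fix)"
  proof -
    have "Fix \<subseteq> E" by (auto simp: Fix_def)
    then show ?thesis
      using assms(3) by (metis add.commute card_Diff_subset card_mono finite_subset le_add_diff_inverse2)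
  qed
  ultimately show ?thesis
    unfolding Fix_def[symmetric] by (metis add.right_neutral mod_add_right_eq dvd_imp_mod_0)
qed

section \<open>Sylow-type arguments by counting fixed cosets\<close>

context group
begin

lemma rcoset_shift_closed:
  "\<lbrakk>subgroup V G; C \<in> rcosets V; g \<in> carrier G\<rbrakk> \<Longrightarrow> C #> g \<in> rcosets V"
  by (auto simp: RCOSETS_def coset_mult_assoc subgroup.subset)

lemma rcoset_fixed_iff:
  assumes "subgroup V G" "g \<in> carrier G" "x \<in> carrier G"
  shows "V #> g #> x = V #> g \<longleftrightarrow> conj_by (inv g) x \<in> V"
proof -
  note sub = subgroup.subset[OF assms(1)]
  have "V #> g #> x = V #> g \<longleftrightarrow> g \<otimes> x \<in> V #> g"
    using assms sub by (metis coset_mult_assoc m_closed rcos_self repr_independence)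
  also have "\<dots> \<longleftrightarrow> g \<otimes> x \<otimes> inv g \<in> V"
    using assms subgroup.rcos_module[OF assms(1) is_group] by simp
  finally show ?thesis
    using assms by (simp add: conj_by_def)
qed

lemma p_subgroup_fixed_rcosets:
  assumes "finite (carrier G)" "Factorial_Ring.prime q" "subgroup Q G" "card Q = q ^ k" "subgroup V G"
  shows "card {C \<in> rcosets V. \<forall>x\<in>Q. C #> x = C} mod q = card (rcosets V) mod q"
proof -
  interpret Q: group "G\<lparr>carrier := Q\<rparr>"
    using assms(3) by (rule subgroup_imp_group)
  note Qs = subgroup.subset[OF assms(3)]
  have cos_sub: "C \<subseteq> carrier G" if "C \<in> rcosets V" for C
    using that subgroup.rcosets_carrier[OF assms(5) is_group] by blast
  \<comment> \<open>Right multiplication is a right action; the inverse turns it into the left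
    action that \<open>group_action\<close> expects.\<close>
  have act: "group_action (G\<lparr>carrier := Q\<rparr>) (rcosets V) (\<lambda>x. \<lambda>C\<in>rcosets V. C #> inv x)"
  proof (rule Q.group_actionI)
    fix x C assume "x \<in> carrier (G\<lparr>carrier := Q\<rparr>)" "C \<in> rcosets V"
    then show "C #> inv x \<in> rcosets V"
      using Qs assms(5) by (auto intro: rcoset_shift_closed)
  next
    fix C assume "C \<in> rcosets V"
    then show "C #> inv \<one>\<^bsub>G\<lparr>carrier := Q\<rparr>\<^esub> = C"
      using cos_sub by simp
  next
    fix x y C assume "x \<in> carrier (G\<lparr>carrier := Q\<rparr>)" "y \<in> carrier (G\<lparr>carrier := Q\<rparr>)" "C \<in> rcosets V"
    then have "x \<in> carrier G" "y \<in> carrier G" "C \<subseteq> carrier G"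
      using Qs cos_sub by auto
    then show "C #> inv (x \<otimes>\<^bsub>G\<lparr>carrier := Q\<rparr>\<^esub> y) = C #> inv y #> inv x"
      by (simp add: inv_mult_group coset_mult_assoc)
  qed
  have fin: "finite (rcosets V)"
    using assms(1,5) by (metis finite_UnionD rcosets_part_G)
  have "{C \<in> rcosets V. \<forall>x\<in>Q. (\<lambda>C\<in>rcosets V. C #> inv x) C = C}
      = {C \<in> rcosets V. \<forall>x\<in>Q. C #> x = C}"
    using subgroup.m_inv_closed[OF assms(3)] Qs inv_inv by (auto simp: subset_iff; metis)
  then show ?thesis
    using group_action.p_group_fixed_points[OF act assms(2) _ fin, of k] assms(4)
    by (simp add: order_def)
qed

text \<open>An index prime to \<open>q\<close> leaves a coset \<open>V #> g\<close> fixed by all of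
  \<open>Q\<close>, which says exactly that \<open>Q\<close> lies in the conjugate of
  \<open>V\<close> by \<open>g\<close>. It serves both as Sylow conjugacy and to move
  \<open>q\<close>-groups into a normalizer.\<close>

lemma p_subgroup_in_conjugate:
  assumes "finite (carrier G)" "Factorial_Ring.prime q" "subgroup Q G" "card Q = q ^ k"
    "subgroup V G" "\<not> q dvd card (rcosets V)"
  obtains g where "g \<in> carrier G" "Q \<subseteq> conj_set G V g"
proof -
  have "card {C \<in> rcosets V. \<forall>x\<in>Q. C #> x = C} mod q \<noteq> 0"
    using p_subgroup_fixed_rcosets[OF assms(1-5)] assms(6) by (simp add: dvd_eq_mod_eq_0)
  then have "{C \<in> rcosets V. \<forall>x\<in>Q. C #> x = C} \<noteq> {}"
    by (metis card.empty mod_0)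
  then obtain g where g: "g \<in> carrier G" "\<forall>x\<in>Q. V #> g #> x = V #> g"
    by (auto simp: RCOSETS_def)
  then have "Q \<subseteq> conj_set G V g"
    using subgroup.subset[OF assms(3)] subgroup.subset[OF assms(5)] assms(5)
    by (auto simp: mem_conj_set_iff rcoset_fixed_iff subset_iff)
  then show ?thesis
    using that g by blast
qed

text \<open>The fixed points of \<open>R\<close> acting on itself by conjugation form its centre, so
  the order of the centre is divisible by \<open>q\<close>.\<close>

lemma p_group_center_nontrivial:
  assumes "Factorial_Ring.prime q" "subgroup R G" "card R = q ^ k" "R \<noteq> {\<one>}"
  obtains a where "a \<in> R" "a \<noteq> \<one>" "\<And>x. x \<in> R \<Longrightarrow> x \<otimes> a = a \<otimes> x"
proof -
  interpret R: group "G\<lparr>carrier := R\<rparr>"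
    using assms(2) by (rule subgroup_imp_group)
  note Rs = subgroup.subset[OF assms(2)]
  have fin: "finite R"
    using assms(1,3) by (metis card.infinite power_eq_0_iff not_prime_0)
  have act: "group_action (G\<lparr>carrier := R\<rparr>) R (\<lambda>x. \<lambda>a\<in>R. conj_by (inv x) a)"
  proof (rule R.group_actionI)
    fix x a assume "x \<in> carrier (G\<lparr>carrier := R\<rparr>)" "a \<in> R"
    then show "conj_by (inv x) a \<in> R"
      using assms(2) by (simp add: subgroup_conj_by subgroup.m_inv_closed)
  next
    fix a assume "a \<in> R"
    then show "conj_by (inv \<one>\<^bsub>G\<lparr>carrier := R\<rparr>\<^esub>) a = a"
      using Rs by auto
  next
    fix x y a assume "x \<in> carrier (G\<lparr>carrier := R\<rparr>)" "y \<in> carrier (G\<lparr>carrier := R\<rparr>)" "a \<in> R"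
    then have "x \<in> carrier G" "y \<in> carrier G" "a \<in> carrier G"
      using Rs by auto
    then show "conj_by (inv (x \<otimes>\<^bsub>G\<lparr>carrier := R\<rparr>\<^esub> y)) a = conj_by (inv x) (conj_by (inv y) a)"
      by (simp add: inv_mult_group mult_conj_by)
  qed
  define Z where "Z = {a \<in> R. \<forall>x\<in>R. (\<lambda>a\<in>R. conj_by (inv x) a) a = a}"
  have "card Z mod q = card R mod q"
    using group_action.p_group_fixed_points[OF act assms(1) _ fin, of k] assms(3)
    by (simp add: Z_def order_def)
  moreover have "q dvd card R"
  proof -
    have "k \<noteq> 0"
      using assms(2-4) subgroup.one_closed by (fastforce simp: card_1_singleton_iff)
    then show ?thesis
      using assms(3) by simp
  qed
  ultimately have "q dvd card Z"
    by (metis mod_0_imp_dvd dvd_imp_mod_0)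
  have "Z \<noteq> {\<one>}"
  proof
    assume "Z = {\<one>}"
    then have "q dvd 1"
      using \<open>q dvd card Z\<close> by simp
    then show False
      using assms(1) not_prime_unit by blast
  qed
  moreover have "\<one> \<in> Z"
    using subgroup.one_closed[OF assms(2)] Rs by (auto simp: Z_def)
  ultimately obtain a where a: "a \<in> Z" "a \<noteq> \<one>"
    by blast
  have "x \<otimes> a = a \<otimes> x" if "x \<in> R" for x
  proof -
    have "conj_by (inv (inv x)) a = a"
      using that a(1) subgroup.m_inv_closed[OF assms(2)] by (auto simp: Z_def)
    then show ?thesis
      using that a(1) Rs conj_by_fixed_iff[of x a] by (auto simp: Z_def subset_iff)
  qed
  then show ?thesis
    using that a by (auto simp: Z_def)
qed

lemma exists_prime_order_subgroup:
  assumes "finite (carrier G)" "Factorial_Ring.prime q" "subgroup H G" "q dvd card H"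
  obtains x where "x \<in> H" "x \<noteq> \<one>" "x [^] q = \<one>" "subgroup (generate G {x}) G" "card (generate G {x}) = q"
proof -
  interpret H: group "G\<lparr>carrier := H\<rparr>"
    using assms(3) by (rule subgroup_imp_group)
  note Hs = subgroup.subset[OF assms(3)]
  \<comment> \<open>\<open>sylow_thm\<close> allows the cofactor to be divisible by
    \<open>q\<close>, so exponent 1 gives Cauchy's theorem.\<close>
  obtain m where "card H = q ^ 1 * m"
    using assms(4) by (auto elim: dvdE)
  then obtain Q where Q: "subgroup Q (G\<lparr>carrier := H\<rparr>)" "card Q = q ^ 1"
    using Sylow.sylow_thm[OF assms(2) H.is_group, of 1 m] assms(1) Hs
    by (auto simp: order_def finite_subset)
  have QG: "subgroup Q G" "Q \<subseteq> H"
    using Q(1) assms(3) incl_subgroup H.subgroup_self subgroup.subset[OF Q(1)] by auto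
  have "Q \<noteq> {\<one>}"
    using Q(2) assms(2) by (auto simp: prime_nat_iff)
  then obtain x where x: "x \<in> Q" "x \<noteq> \<one>"
    using subgroup.one_closed[OF QG(1)] by blast
  have xG: "x \<in> carrier G"
    using x QG Hs by auto
  have pow: "x [^] q = \<one>"
  proof -
    interpret Q: group "G\<lparr>carrier := Q\<rparr>"
      using QG(1) by (rule subgroup_imp_group)
    have "x [^]\<^bsub>G\<lparr>carrier := Q\<rparr>\<^esub> order (G\<lparr>carrier := Q\<rparr>) = \<one>\<^bsub>G\<lparr>carrier := Q\<rparr>\<^esub>"
      using x by (intro Q.pow_order_eq_1) simp
    then show ?thesis
      using Q(2) by (simp add: order_def flip: nat_pow_consistent)
  qed
  have "ord x = q"
    using pow x xG assms(2) by (metis ord_eq_1 pow_eq_id prime_nat_iff)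
  then have "card (generate G {x}) = q"
    using xG generate_pow_card by simp
  moreover have "subgroup (generate G {x}) G"
    using xG by (intro generate_is_subgroup) simp
  ultimately show ?thesis
    using that x QG(2) pow by blast
qed

text \<open>A subgroup of order \<open>q\<close> in \<open>F\<close> fixes no right coset except
  \<open>F\<close> itself, since a fixed \<open>F #> g\<close> would conjugate a nontrivial element
  of \<open>F\<close> into \<open>F\<close>. Therefore the index is 1 modulo
  \<open>q\<close>.\<close>

lemma malnormal_index_coprime:
  assumes "finite (carrier G)" "malnormal F G" "Factorial_Ring.prime q" "q dvd card F"
  shows "\<not> q dvd card (rcosets F)"
proof -
  have sub: "subgroup F G" and mal: "\<And>g f. \<lbrakk>g \<in> carrier G; f \<in> F; f \<noteq> \<one>; conj_by g f \<in> F\<rbrakk> \<Longrightarrow> g \<in> F"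
    using assms(2) by (auto simp: malnormal_iff)
  note Fs = subgroup.subset[OF sub]
  obtain x where x: "x \<in> F" "x \<noteq> \<one>" "subgroup (generate G {x}) G" "card (generate G {x}) = q"
    using exists_prime_order_subgroup[OF assms(1,3) sub assms(4)] by blast
  define Q where "Q = generate G {x}"
  have QF: "Q \<subseteq> F"
    unfolding Q_def using x(1) sub by (intro generate_subgroup_incl) auto
  have xQ: "x \<in> Q"
    by (simp add: Q_def generate.incl)
  have "{C \<in> rcosets F. \<forall>x\<in>Q. C #> x = C} = {F}"
  proof (intro equalityI subsetI)
    fix C assume "C \<in> {C \<in> rcosets F. \<forall>x\<in>Q. C #> x = C}"
    then obtain g where g: "g \<in> carrier G" "C = F #> g" "F #> g #> x = F #> g"
      using xQ by (auto simp: RCOSETS_def)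
    then have "conj_by (inv g) x \<in> F"
      using rcoset_fixed_iff[OF sub] x(1) Fs by blast
    then have "inv g \<in> F"
      using mal x(1,2) g(1) by blast
    then have "g \<in> F"
      using subgroup.m_inv_closed[OF sub] g(1) by fastforce
    then show "C \<in> {F}"
      using g(2) sub by (simp add: subgroup.rcos_const[OF sub is_group])
  next
    fix C assume "C \<in> {F}"
    then show "C \<in> {C \<in> rcosets F. \<forall>x\<in>Q. C #> x = C}"
      using QF sub subgroup.rcos_const[OF sub is_group] subgroup.subgroup_in_rcosets[OF sub is_group] by auto
  qed
  then have "card (rcosets F) mod q = 1 mod q"
    using p_subgroup_fixed_rcosets[OF assms(1,3), of Q 1 F] x sub by (simp add: Q_def)
  then show ?thesis
    using assms(3) by (metis dvd_imp_mod_0 mod_0_imp_dvd not_prime_unit)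
qed

end

subsection \<open>Transfer\<close>

context group
begin

text \<open>Here \<open>\<phi> x\<close> stands for the image under \<open>\<pi>\<close> of the
  \<open>F\<close>-part of \<open>x\<close> relative to some transversal; only its equivariance
  matters. The quotient of \<open>\<phi> (x \<otimes> g)\<close> by \<open>\<phi> x\<close> then
  depends on the coset alone, because \<open>A\<close> is abelian, and reindexing the cosets makes
  the product multiplicative in \<open>g\<close>. The second conclusion lets the transfer be
  evaluated with any function that has the right values on cosets.\<close>

lemma transfer_hom:
  assumes A: "comm_group A" and F: "subgroup F G"
    and \<phi>: "\<phi> \<in> carrier G \<rightarrow> carrier A" and \<pi>: "\<pi> \<in> F \<rightarrow> carrier A"
    and equi: "\<And>f x. \<lbrakk>f \<in> F; x \<in> carrier G\<rbrakk> \<Longrightarrow> \<phi> (f \<otimes> x) = \<pi> f \<otimes>\<^bsub>A\<^esub> \<phi> x"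
  obtains V where "V \<in> hom G A"
    and "\<And>g s. \<lbrakk>g \<in> carrier G; \<And>x. x \<in> carrier G \<Longrightarrow> s (F #> x) = inv\<^bsub>A\<^esub> (\<phi> x) \<otimes>\<^bsub>A\<^esub> \<phi> (x \<otimes> g)\<rbrakk>
      \<Longrightarrow> V g = finprod A s (rcosets F)"
proof -
  interpret A: comm_group A by fact
  note Fs = subgroup.subset[OF F]
  note [simp] = funcset_mem[OF \<phi>] funcset_mem[OF \<pi>]
  define shift where
    "shift g C = the_elem ((\<lambda>x. inv\<^bsub>A\<^esub> (\<phi> x) \<otimes>\<^bsub>A\<^esub> \<phi> (x \<otimes> g)) ` C)" for g C
  have shift: "shift g (F #> x) = inv\<^bsub>A\<^esub> (\<phi> x) \<otimes>\<^bsub>A\<^esub> \<phi> (x \<otimes> g)"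
    if x: "x \<in> carrier G" and g: "g \<in> carrier G" for g x
  proof -
    have "inv\<^bsub>A\<^esub> (\<phi> y) \<otimes>\<^bsub>A\<^esub> \<phi> (y \<otimes> g) = inv\<^bsub>A\<^esub> (\<phi> x) \<otimes>\<^bsub>A\<^esub> \<phi> (x \<otimes> g)" if y: "y \<in> F #> x" for y
    proof -
      obtain f where f: "f \<in> F" "y = f \<otimes> x"
        using y by (auto simp: r_coset_def)
      have fG: "f \<in> carrier G"
        using f Fs by blast
      have "\<phi> y = \<pi> f \<otimes>\<^bsub>A\<^esub> \<phi> x"
        using f x equi by simp
      moreover have "\<phi> (y \<otimes> g) = \<pi> f \<otimes>\<^bsub>A\<^esub> \<phi> (x \<otimes> g)"
        using f(1) equi[OF f(1), of "x \<otimes> g"] x g fG by (simp add: f(2) m_assoc)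
      ultimately show ?thesis
        using x g f(1) by (simp add: A.inv_mult_group A.m_assoc)
    qed
    moreover have "x \<in> F #> x"
      using x F by (rule rcos_self)
    ultimately have "(\<lambda>x. inv\<^bsub>A\<^esub> (\<phi> x) \<otimes>\<^bsub>A\<^esub> \<phi> (x \<otimes> g)) ` (F #> x)
        = {inv\<^bsub>A\<^esub> (\<phi> x) \<otimes>\<^bsub>A\<^esub> \<phi> (x \<otimes> g)}"
      by blast
    then show ?thesis
      by (simp add: shift_def)
  qed
  have shift_closed: "shift g \<in> rcosets F \<rightarrow> carrier A" if "g \<in> carrier G" for g
    using that shift by (auto simp: RCOSETS_def)
  have shift_mult: "shift (g \<otimes> h) C = shift g C \<otimes>\<^bsub>A\<^esub> shift h (C #> g)"
    if that: "g \<in> carrier G" "h \<in> carrier G" and C: "C \<in> rcosets F" for g h C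
  proof -
    obtain x where x: "x \<in> carrier G" "C = F #> x"
      using C by (auto simp: RCOSETS_def)
    have "C #> g = F #> (x \<otimes> g)"
      using x that Fs by (simp add: coset_mult_assoc)
    then show ?thesis
      using x that by (simp add: shift m_assoc A.m_assoc)
  qed
  have reindex: "finprod A (\<lambda>C. shift h (C #> g)) (rcosets F) = finprod A (shift h) (rcosets F)"
    if "g \<in> carrier G" "h \<in> carrier G" for g h
  proof -
    have Cs: "C \<subseteq> carrier G" if "C \<in> rcosets F" for C
      using that subgroup.rcosets_carrier[OF F is_group] by blast
    have bij: "bij_betw (\<lambda>C. C #> g) (rcosets F) (rcosets F)"
      using that Cs
      by (intro bij_betw_byWitness[where f' = "\<lambda>C. C #> inv g"])
        (auto simp: coset_mult_assoc intro!: rcoset_shift_closed[OF F])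
    then show ?thesis
      using A.finprod_reindex[of "shift h" "\<lambda>C. C #> g" "rcosets F"] shift_closed[OF that(2)]
      by (auto simp: bij_betw_def)
  qed
  define V where "V g = finprod A (shift g) (rcosets F)" for g
  have V: "V \<in> hom G A"
  proof (rule homI)
    fix g h assume gh: "g \<in> carrier G" "h \<in> carrier G"
    have "V (g \<otimes> h) = finprod A (\<lambda>C. shift g C \<otimes>\<^bsub>A\<^esub> shift h (C #> g)) (rcosets F)"
      unfolding V_def
      using gh shift_closed shift_mult rcoset_shift_closed[OF F]
      by (intro A.finprod_cong') (auto simp: Pi_iff)
    also have "\<dots> = V g \<otimes>\<^bsub>A\<^esub> finprod A (\<lambda>C. shift h (C #> g)) (rcosets F)"
      unfolding V_def using gh shift_closed rcoset_shift_closed[OF F]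
      by (intro A.finprod_multf) (auto simp: Pi_iff)
    finally show "V (g \<otimes> h) = V g \<otimes>\<^bsub>A\<^esub> V h"
      using reindex[OF gh] by (simp add: V_def)
  qed (use shift_closed in \<open>auto simp: V_def intro: A.finprod_closed\<close>)
  moreover have "V g = finprod A s (rcosets F)"
    if "g \<in> carrier G" "\<And>x. x \<in> carrier G \<Longrightarrow> s (F #> x) = inv\<^bsub>A\<^esub> (\<phi> x) \<otimes>\<^bsub>A\<^esub> \<phi> (x \<otimes> g)" for g s
    unfolding V_def
    using that by (intro A.finprod_cong') (auto simp: RCOSETS_def shift)
  ultimately show ?thesis
    by (rule that)
qed

text \<open>
  Since \<open>F\<close> acts freely by right multiplication on the right cosets other than \<open>F\<close>, coset
  representatives can be chosen equivariantly; with respect to them only the coset \<open>F\<close> itself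
  contributes to the transfer of an element of \<open>F\<close>.
\<close>

lemma malnormal_hom_extends:
  assumes fin: "finite (carrier G)" and mal: "malnormal F G" and A: "comm_group A"
    and \<pi>: "\<pi> \<in> hom (G\<lparr>carrier := F\<rparr>) A"
  obtains V where "V \<in> hom G A" "\<And>f. f \<in> F \<Longrightarrow> V f = \<pi> f"
proof -
  interpret A: comm_group A by fact
  have F: "subgroup F G"
    and mal': "\<And>g f. \<lbrakk>g \<in> carrier G; f \<in> F; f \<noteq> \<one>; conj_by g f \<in> F\<rbrakk> \<Longrightarrow> g \<in> F"
    using mal by (auto simp: malnormal_iff)
  note Fs = subgroup.subset[OF F]
  have FG [simp]: "f \<in> carrier G" if "f \<in> F" for f
    using that Fs by blast
  note [simp] = subgroup.m_closed[OF F] subgroup.m_inv_closed[OF F] subgroup.one_closed[OF F]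
  have \<pi>_closed [simp]: "\<pi> f \<in> carrier A" if "f \<in> F" for f
    using \<pi> that by (auto simp: hom_def)
  have \<pi>_mult: "\<pi> (f \<otimes> f') = \<pi> f \<otimes>\<^bsub>A\<^esub> \<pi> f'" if "f \<in> F" "f' \<in> F" for f f'
    using \<pi> that by (auto simp: hom_def)
  \<comment> \<open>\<open>rep\<close> picks one element in each double coset of \<open>F\<close>,
    and \<open>\<beta> x\<close> is the left factor of \<open>x\<close> relative to it. Within
    \<open>F\<close> such a factor is not unique; there \<open>\<beta>\<close> is the identity,
    which corresponds to the representative \<open>\<one>\<close>.\<close>
  define dbl where "dbl x = {t. \<exists>a\<in>F. \<exists>b\<in>F. t = a \<otimes> x \<otimes> b}" for x
  define rep where "rep x = (SOME t. t \<in> dbl x)" for x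
  define \<beta> where "\<beta> x = (if x \<in> F then x else (SOME a. a \<in> F \<and> (\<exists>b\<in>F. x = a \<otimes> rep x \<otimes> b)))" for x
  have mult_F_iff: "f \<otimes> x \<in> F \<longleftrightarrow> x \<in> F" "x \<otimes> f \<in> F \<longleftrightarrow> x \<in> F"
    if "f \<in> F" "x \<in> carrier G" for f x
    using that F by (metis FG inv_mult_cancel(1) subgroup.m_closed subgroup.m_inv_closed,
        metis FG inv_closed inv_solve_right m_closed subgroup.m_closed subgroup.m_inv_closed F)
  have dbl_left: "dbl (f \<otimes> x) = dbl x" if "f \<in> F" "x \<in> carrier G" for f x
  proof -
    have "a \<otimes> x \<otimes> b = (a \<otimes> inv f) \<otimes> (f \<otimes> x) \<otimes> b" "a \<otimes> (f \<otimes> x) \<otimes> b = (a \<otimes> f) \<otimes> x \<otimes> b"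
      if "a \<in> F" "b \<in> F" for a b
      using that \<open>f \<in> F\<close> \<open>x \<in> carrier G\<close> by (simp_all add: m_assoc)
    then show ?thesis
      unfolding dbl_def using \<open>f \<in> F\<close> by (metis (no_types, opaque_lifting) F subgroup.m_closed subgroup.m_inv_closed)
  qed
  have dbl_right: "dbl (x \<otimes> f) = dbl x" if "f \<in> F" "x \<in> carrier G" for f x
  proof -
    have "a \<otimes> x \<otimes> b = a \<otimes> (x \<otimes> f) \<otimes> (inv f \<otimes> b)" "a \<otimes> (x \<otimes> f) \<otimes> b = a \<otimes> x \<otimes> (f \<otimes> b)"
      if "a \<in> F" "b \<in> F" for a b
      using that \<open>f \<in> F\<close> \<open>x \<in> carrier G\<close> by (simp_all add: m_assoc)
    then show ?thesis
      unfolding dbl_def using \<open>f \<in> F\<close> by (metis (no_types, opaque_lifting) F subgroup.m_closed subgroup.m_inv_closed)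
  qed
  have rep: "rep x \<in> carrier G" "rep x \<notin> F" "\<exists>a\<in>F. \<exists>b\<in>F. x = a \<otimes> rep x \<otimes> b"
    if x: "x \<in> carrier G" "x \<notin> F" for x
  proof -
    have "x = \<one> \<otimes> x \<otimes> \<one>"
      using x by simp
    then have "x \<in> dbl x"
      unfolding dbl_def using subgroup.one_closed[OF F] by blast
    then have "rep x \<in> dbl x"
      unfolding rep_def by (rule someI)
    then obtain a b where ab: "a \<in> F" "b \<in> F" "rep x = a \<otimes> x \<otimes> b"
      by (auto simp: dbl_def)
    show "rep x \<in> carrier G" "rep x \<notin> F"
      using ab x by (auto simp: mult_F_iff)
    have "x = inv a \<otimes> rep x \<otimes> inv b"
      using ab x by (simp add: m_assoc)
    then show "\<exists>a\<in>F. \<exists>b\<in>F. x = a \<otimes> rep x \<otimes> b"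
      using ab by (metis F subgroup.m_inv_closed)
  qed
  \<comment> \<open>This is the freeness of the action: two different left factors would give a
    nontrivial element of \<open>F\<close> whose conjugate by \<open>t\<close> is again in
    \<open>F\<close>, forcing \<open>t\<close> into \<open>F\<close>.\<close>
  have uniq: "a = a'" if "a \<in> F" "b \<in> F" "a' \<in> F" "b' \<in> F" "t \<in> carrier G" "t \<notin> F"
    "a \<otimes> t \<otimes> b = a' \<otimes> t \<otimes> b'" for a b a' b' t
  proof (rule ccontr)
    assume "a \<noteq> a'"
    have "conj_by t (inv a' \<otimes> a) = inv t \<otimes> inv a' \<otimes> (a \<otimes> t \<otimes> b) \<otimes> inv b"
      using that(1-6) by (simp add: conj_by_def m_assoc)
    also have "\<dots> = b' \<otimes> inv b"
      unfolding that(7) using that(1-6) by (simp add: m_assoc)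
    also have "\<dots> \<in> F"
      using that by simp
    finally have "conj_by t (inv a' \<otimes> a) \<in> F" .
    moreover have "inv a' \<otimes> a \<noteq> \<one>"
      using that \<open>a \<noteq> a'\<close> by (metis FG inv_closed inv_equality inv_inv)
    ultimately have "t \<in> F"
      using that mal'[of t "inv a' \<otimes> a"] by simp
    then show False
      using that by blast
  qed
  have \<beta>: "\<beta> x \<in> F \<and> (\<exists>b\<in>F. x = \<beta> x \<otimes> rep x \<otimes> b)" if "x \<in> carrier G" "x \<notin> F" for x
    using that rep(3)[OF that] someI_ex[of "\<lambda>a. a \<in> F \<and> (\<exists>b\<in>F. x = a \<otimes> rep x \<otimes> b)"]
    by (auto simp: \<beta>_def)
  have \<beta>_F: "\<beta> x \<in> F" if "x \<in> carrier G" for x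
    using that \<beta>[of x] by (cases "x \<in> F") (auto simp: \<beta>_def)
  have \<beta>_left: "\<beta> (f \<otimes> x) = f \<otimes> \<beta> x" if f: "f \<in> F" and x: "x \<in> carrier G" for f x
  proof (cases "x \<in> F")
    case False
    obtain b where b: "b \<in> F" "x = \<beta> x \<otimes> rep x \<otimes> b" "\<beta> x \<in> F"
      using \<beta>[OF x False] by blast
    have fx: "f \<otimes> x \<in> carrier G" "f \<otimes> x \<notin> F"
      using f x False by (auto simp: mult_F_iff)
    then obtain b' where b': "b' \<in> F" "f \<otimes> x = \<beta> (f \<otimes> x) \<otimes> rep (f \<otimes> x) \<otimes> b'" "\<beta> (f \<otimes> x) \<in> F"
      using \<beta>[OF fx] by blast
    have req: "rep (f \<otimes> x) = rep x"
      using f x by (simp add: rep_def dbl_left)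
    have "f \<otimes> x = f \<otimes> (\<beta> x \<otimes> rep x \<otimes> b)"
      using b(2) by simp
    also have "\<dots> = (f \<otimes> \<beta> x) \<otimes> rep x \<otimes> b"
      using f b(1,3) rep(1)[OF x False] by (simp add: m_assoc)
    finally have "\<beta> (f \<otimes> x) \<otimes> rep x \<otimes> b' = (f \<otimes> \<beta> x) \<otimes> rep x \<otimes> b"
      using b'(2) unfolding req by simp
    then show ?thesis
      using uniq[of "\<beta> (f \<otimes> x)" b' "f \<otimes> \<beta> x" b "rep x"] b b' f rep(1,2)[OF x False] by simp
  qed (use f in \<open>simp add: \<beta>_def\<close>)
  have \<beta>_right: "\<beta> (x \<otimes> f) = \<beta> x" if f: "f \<in> F" and x: "x \<in> carrier G" "x \<notin> F" for f x
  proof -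
    obtain b where b: "b \<in> F" "x = \<beta> x \<otimes> rep x \<otimes> b" "\<beta> x \<in> F"
      using \<beta>[OF x] by blast
    have xf: "x \<otimes> f \<in> carrier G" "x \<otimes> f \<notin> F"
      using f x by (auto simp: mult_F_iff)
    then obtain b' where b': "b' \<in> F" "x \<otimes> f = \<beta> (x \<otimes> f) \<otimes> rep (x \<otimes> f) \<otimes> b'" "\<beta> (x \<otimes> f) \<in> F"
      using \<beta>[OF xf] by blast
    have req: "rep (x \<otimes> f) = rep x"
      using f x by (simp add: rep_def dbl_right)
    have "x \<otimes> f = (\<beta> x \<otimes> rep x \<otimes> b) \<otimes> f"
      using b(2) by simp
    also have "\<dots> = \<beta> x \<otimes> rep x \<otimes> (b \<otimes> f)"
      using f b(1,3) rep(1)[OF x] by (simp add: m_assoc)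
    finally have "\<beta> (x \<otimes> f) \<otimes> rep x \<otimes> b' = \<beta> x \<otimes> rep x \<otimes> (b \<otimes> f)"
      using b'(2) unfolding req by simp
    then show ?thesis
      using uniq[of "\<beta> (x \<otimes> f)" b' "\<beta> x" "b \<otimes> f" "rep x"] b b' f rep(1,2)[OF x] by simp
  qed
  have fin_cos: "finite (rcosets F)"
    using fin F by (metis finite_UnionD rcosets_part_G)
  have pi_Pi: "\<pi> \<in> F \<rightarrow> carrier A"
    by auto
  have phi_Pi: "(\<lambda>x. \<pi> (\<beta> x)) \<in> carrier G \<rightarrow> carrier A"
    using \<beta>_F by auto
  obtain V where V: "V \<in> hom G A"
    "\<And>g s. \<lbrakk>g \<in> carrier G; \<And>x. x \<in> carrier G \<Longrightarrow> s (F #> x) = inv\<^bsub>A\<^esub> (\<pi> (\<beta> x)) \<otimes>\<^bsub>A\<^esub> \<pi> (\<beta> (x \<otimes> g))\<rbrakk>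
      \<Longrightarrow> V g = finprod A s (rcosets F)"
    using transfer_hom[OF A F phi_Pi pi_Pi] \<beta>_left \<beta>_F \<pi>_mult by auto
  have "V f = \<pi> f" if f: "f \<in> F" for f
  proof -
    have "V f = finprod A (\<lambda>C. if F = C then \<pi> f else \<one>\<^bsub>A\<^esub>) (rcosets F)"
    proof (rule V(2))
      fix x assume x: "x \<in> carrier G"
      show "(if F = F #> x then \<pi> f else \<one>\<^bsub>A\<^esub>) = inv\<^bsub>A\<^esub> (\<pi> (\<beta> x)) \<otimes>\<^bsub>A\<^esub> \<pi> (\<beta> (x \<otimes> f))"
      proof (cases "x \<in> F")
        case True
        then show ?thesis
          using f x subgroup.rcos_const[OF F is_group True] by (simp add: \<beta>_def \<pi>_mult A.m_assoc[symmetric])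
      next
        case False
        then have "F \<noteq> F #> x"
          using rcos_self[OF x F] by blast
        then show ?thesis
          using f x False \<beta>_right \<beta>_F by simp
      qed
    qed (use f in simp)
    also have "\<dots> = \<pi> f"
      using A.finprod_singleton[of F "rcosets F" "\<lambda>_. \<pi> f"] fin_cos f
        subgroup.subgroup_in_rcosets[OF F is_group] by simp
    finally show ?thesis .
  qed
  then show ?thesis
    using that V(1) by blast
qed

text \<open>\<open>N\<close> is the kernel of an extension to \<open>G\<close> of the projection of
  \<open>F\<close> onto its abelianization. The extension takes no new values, so \<open>G\<close>
  modulo \<open>N\<close> is as large as \<open>F\<close> modulo its derived subgroup.\<close>

lemma malnormal_transfer_kernel:
  assumes fin: "finite (carrier G)" and mal: "malnormal F G"
  obtains N where "N \<lhd> G" "N \<inter> F = derived G F"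
    "card (rcosets N) * card (derived G F) = card F"
proof -
  have F: "subgroup F G"
    using mal by (simp add: malnormal_def)
  note Fs = subgroup.subset[OF F]
  interpret F: group "G\<lparr>carrier := F\<rparr>"
    using F by (rule subgroup_imp_group)
  define K where "K = derived G F"
  define A where "A = G\<lparr>carrier := F\<rparr> Mod K"
  interpret K: normal K "G\<lparr>carrier := F\<rparr>"
    unfolding K_def using F by (rule derived_subgroup_is_normal)
  interpret A: comm_group A
    unfolding A_def K_def using F by (rule derived_quot_of_subgroup_is_comm_group)
  have "(\<lambda>f. K #>\<^bsub>G\<lparr>carrier := F\<rparr>\<^esub> f) \<in> hom (G\<lparr>carrier := F\<rparr>) A"
    unfolding A_def by (rule K.r_coset_hom_Mod)
  then obtain V where V: "V \<in> hom G A" "\<And>f. f \<in> F \<Longrightarrow> V f = K #> f"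
    using malnormal_hom_extends[OF fin mal A.comm_group_axioms] by auto
  interpret V: group_hom G A V
    using V(1) by unfold_locales
  have carrier_A: "carrier A = (\<lambda>f. K #> f) ` F"
    by (simp add: A_def carrier_FactGroup)
  have surj: "V ` carrier G = carrier A"
  proof
    show "V ` carrier G \<subseteq> carrier A" by auto
    show "carrier A \<subseteq> V ` carrier G"
      using carrier_A V(2) Fs by (metis (mono_tags, lifting) image_cong image_mono)
  qed
  define N where "N = kernel G A V"
  have "N \<inter> F = K"
  proof -
    have "f \<in> N \<longleftrightarrow> f \<in> K" if f: "f \<in> F" for f
    proof -
      have KG: "subgroup K G" "K \<subseteq> F"
        unfolding K_def using F Fs derived_is_subgroup derived_incl by auto
      have "f \<in> N \<longleftrightarrow> K #> f = K"
        using f Fs V(2) by (auto simp: N_def kernel_def A_def)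
      also have "\<dots> \<longleftrightarrow> f \<in> K"
        using f Fs KG by (metis coset_join1 coset_join2 subgroup.subset subsetD)
      finally show ?thesis .
    qed
    moreover have "K \<subseteq> F"
      unfolding K_def using F by (rule derived_incl[rotated]) simp
    ultimately show ?thesis by blast
  qed
  moreover have "card (rcosets N) * card K = card F"
  proof -
    have "(\<lambda>C. the_elem (V ` C)) \<in> iso (G Mod N) A"
      unfolding N_def using surj by (rule V.FactGroup_iso_set)
    then have "card (carrier (G Mod N)) = card (carrier A)"
      by (meson is_isoI iso_same_card)
    moreover have "card (carrier A) * card K = card F"
      using F.lagrange[OF K.is_subgroup] by (simp add: A_def FactGroup_def order_def)
    ultimately show ?thesis
      by (simp add: FactGroup_def)
  qed
  moreover have "N \<lhd> G"
    unfolding N_def by (rule V.normal_kernel)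
  ultimately show ?thesis
    using that[of N] by (simp add: K_def)
qed

end

text \<open>For finite groups this is solubility. Excluding perfect subgroups passes to smaller
  \<open>F\<close> at once and directly makes the derived subgroup of a nontrivial subgroup
  \<open>F\<close> proper, which is what the descent consumes.\<close>

definition hypoabelian :: "'a set \<Rightarrow> ('a, 'b) monoid_scheme \<Rightarrow> bool" where
  "hypoabelian F G \<longleftrightarrow> (\<forall>U. subgroup U G \<longrightarrow> U \<subseteq> F \<longrightarrow> derived G U = U \<longrightarrow> U = {\<one>\<^bsub>G\<^esub>})"

section \<open>Coprime powers, quotients and the Frattini argument\<close>

context group
begin

lemma conj_set_consistent:
  assumes "subgroup N G" "g \<in> N"
  shows "conj_set (G\<lparr>carrier := N\<rparr>) H g = conj_set G H g"
  using assms by (simp add: conj_set_def)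

lemma normalizer_consistent:
  assumes "subgroup N G" "H \<subseteq> N"
  shows "normalizer (G\<lparr>carrier := N\<rparr>) H = normalizer G H \<inter> N"
proof -
  interpret N: group "G\<lparr>carrier := N\<rparr>"
    using assms(1) by (rule subgroup_imp_group)
  have "H \<subseteq> carrier G"
    using assms subgroup.subset by blast
  then show ?thesis
    using assms subgroup.subset[OF assms(1)]
    by (auto simp: N.mem_normalizer_iff mem_normalizer_iff conj_set_consistent)
qed

text \<open>Bezout's identity. With the trivial subgroup as \<open>N\<close> it shows that an
  element killed by two coprime exponents is trivial.\<close>

lemma pow_mem_subgroup_coprime:
  assumes "subgroup N G" "x \<in> carrier G" "coprime m n" "x [^] (m::nat) \<in> N" "x [^] (n::nat) \<in> N"
  shows "x \<in> N"
proof -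
  have "\<exists>a b. int m * a + int n * b = 1"
    using assms(3) bezout_int[of "int m" "int n"] by (metis coprime_int_iff coprime_iff_gcd_eq_1 mult.commute)
  then obtain a b where ab: "int m * a + int n * b = 1"
    by blast
  have "x = x [^] (int m * a + int n * b)"
    using ab assms(2) by (simp add: int_pow_1)
  also have "\<dots> = (x [^] m) [^] a \<otimes> (x [^] n) [^] b"
    using assms(2) by (simp add: int_pow_mult int_pow_pow flip: int_pow_int)
  also have "\<dots> \<in> N"
    using assms(1,4,5) by (meson subgroup.m_closed subgroup_int_pow_closed)
  finally show ?thesis .
qed

lemma pow_card_subgroup:
  assumes "subgroup H G" "x \<in> H"
  shows "x [^] card H = \<one>"
proof -
  interpret H: group "G\<lparr>carrier := H\<rparr>"
    using assms(1) by (rule subgroup_imp_group)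
  have "x [^]\<^bsub>G\<lparr>carrier := H\<rparr>\<^esub> order (G\<lparr>carrier := H\<rparr>) = \<one>\<^bsub>G\<lparr>carrier := H\<rparr>\<^esub>"
    using assms(2) by (intro H.pow_order_eq_1) simp
  then show ?thesis
    by (simp add: order_def flip: nat_pow_consistent)
qed

lemma pow_index_normal:
  assumes "N \<lhd> G" "x \<in> carrier G"
  shows "x [^] card (rcosets N) \<in> N"
proof -
  interpret normal N G by fact
  interpret Q: group "G Mod N"
    by (rule factorgroup_is_group)
  have "(N #> x) [^]\<^bsub>G Mod N\<^esub> order (G Mod N) = \<one>\<^bsub>G Mod N\<^esub>"
    using assms(2) by (intro Q.pow_order_eq_1) (auto simp: carrier_FactGroup)
  then have "N #> x [^] card (rcosets N) = N"
    using FactGroup_pow[OF assms(2)] by (simp add: order_def FactGroup_def)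
  then show ?thesis
    using assms(2) by (metis coset_join1 nat_pow_closed is_subgroup subset)
qed

text \<open>Any conjugate of \<open>R\<close> under \<open>G\<close> lies in \<open>N\<close> and is
  conjugate to \<open>R\<close> already under \<open>N\<close>. So the normalizer of
  \<open>R\<close> covers \<open>G\<close> modulo \<open>N\<close>, and comparing the two quotients
  gives the count.\<close>

lemma frattini:
  assumes fin: "finite (carrier G)" and N: "N \<lhd> G" and r: "Factorial_Ring.prime r"
    and R: "subgroup R G" "R \<subseteq> N" "card R = r ^ k" "\<not> r dvd card (rcosets\<^bsub>G\<lparr>carrier := N\<rparr>\<^esub> R)"
  shows "card (normalizer G R) = card (rcosets N) * card (normalizer G R \<inter> N)"
proof -
  interpret N: normal N G by fact
  interpret GN: group "G\<lparr>carrier := N\<rparr>"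
    using N.is_subgroup by (rule subgroup_imp_group)
  note Rs = subgroup.subset[OF R(1)]
  define M where "M = normalizer G R"
  have M: "subgroup M G"
    unfolding M_def using Rs by (rule normalizer_imp_subgroup)
  note Ms = subgroup.subset[OF M]
  interpret GM: group "G\<lparr>carrier := M\<rparr>"
    using M by (rule subgroup_imp_group)
  interpret Q: group "G Mod N"
    by (rule N.factorgroup_is_group)
  have R_N: "subgroup R (G\<lparr>carrier := N\<rparr>)"
    using R N.is_subgroup by (simp add: subgroup_incl)
  have surj: "\<exists>m\<in>M. N #> m = N #> g" if g: "g \<in> carrier G" for g
  proof -
    have Rg: "subgroup (conj_set G R g) G"
      using R(1) g by (rule subgroup_conj_set)
    have RgN: "conj_set G R g \<subseteq> N"
      using R g N.inv_op_closed1 by (auto simp: conj_set_def)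
    have "finite N"
      using fin N.subset finite_subset by blast
    moreover have "card (conj_set G R g) = r ^ k"
      using R g Rs by (simp add: card_conj_set)
    moreover have "subgroup (conj_set G R g) (G\<lparr>carrier := N\<rparr>)"
      using Rg RgN N.is_subgroup by (simp add: subgroup_incl)
    ultimately obtain n where n: "n \<in> N" "conj_set G R g \<subseteq> conj_set (G\<lparr>carrier := N\<rparr>) R n"
      using GN.p_subgroup_in_conjugate[of r "conj_set G R g" k R] r R_N R(4) by auto
    have nG: "n \<in> carrier G"
      using n N.subset by blast
    have "conj_by (g \<otimes> inv n) x \<in> R" if x: "x \<in> R" for x
    proof -
      have "conj_by g x \<in> conj_set G R n"
        using n x N.is_subgroup by (auto simp: conj_set_consistent conj_set_eq)
      then show ?thesis
        using x g nG Rs by (simp add: mem_conj_set_iff mult_conj_by subset_iff)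
    qed
    then have "g \<otimes> inv n \<in> M"
      unfolding M_def using g nG Rs fin by (intro mem_normalizerI) (auto intro: finite_subset)
    moreover have "N #> (g \<otimes> inv n) = N #> g"
    proof -
      have "g \<otimes> inv n = (g \<otimes> inv n \<otimes> inv g) \<otimes> g"
        using g nG by (simp add: m_assoc)
      moreover have "g \<otimes> inv n \<otimes> inv g \<in> N"
        using g n by (simp add: N.inv_op_closed2)
      ultimately have "g \<otimes> inv n \<in> N #> g"
        using g N.subset by (metis rcosI)
      then show ?thesis
        using g N.is_subgroup by (metis repr_independence)
    qed
    ultimately show ?thesis by blast
  qed
  define h where "h m = N #> m" for m
  have hom: "h \<in> hom (G\<lparr>carrier := M\<rparr>) (G Mod N)"
    using Ms by (auto simp: hom_def h_def N.rcos_sum FactGroup_def RCOSETS_def subset_iff)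
  interpret h: group_hom "G\<lparr>carrier := M\<rparr>" "G Mod N" h
    using hom by unfold_locales
  have h_surj: "h ` carrier (G\<lparr>carrier := M\<rparr>) = carrier (G Mod N)"
  proof
    show "h ` carrier (G\<lparr>carrier := M\<rparr>) \<subseteq> carrier (G Mod N)"
      by auto
    show "carrier (G Mod N) \<subseteq> h ` carrier (G\<lparr>carrier := M\<rparr>)"
    proof
      fix C assume "C \<in> carrier (G Mod N)"
      then obtain g where g: "g \<in> carrier G" "C = N #> g"
        by (auto simp: carrier_FactGroup)
      then obtain m where "m \<in> M" "C = h m"
        using surj[OF g(1)] by (auto simp: h_def)
      then show "C \<in> h ` carrier (G\<lparr>carrier := M\<rparr>)"
        by simp
    qed
  qed
  have ker: "kernel (G\<lparr>carrier := M\<rparr>) (G Mod N) h = M \<inter> N"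
  proof -
    have "N #> m = N \<longleftrightarrow> m \<in> N" if "m \<in> carrier G" for m
      using that N.subset N.is_subgroup by (metis coset_join1 coset_join2)
    then show ?thesis
      using Ms by (auto simp: kernel_def h_def)
  qed
  have "(\<lambda>C. the_elem (h ` C)) \<in> iso (G\<lparr>carrier := M\<rparr> Mod (M \<inter> N)) (G Mod N)"
    using h.FactGroup_iso_set[OF h_surj] by (simp only: ker)
  then have "card (rcosets\<^bsub>G\<lparr>carrier := M\<rparr>\<^esub> (M \<inter> N)) = card (rcosets N)"
    by (metis (no_types, lifting) FactGroup_def is_isoI iso_same_card partial_object.select_convs(1))
  moreover have "card (rcosets\<^bsub>G\<lparr>carrier := M\<rparr>\<^esub> (M \<inter> N)) * card (M \<inter> N) = card M"
    using GM.lagrange[OF h.subgroup_kernel] by (simp add: ker order_def)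
  ultimately show ?thesis
    by (simp add: M_def)
qed

end

text \<open>Induction on the order of \<open>F\<close>, passing from \<open>F\<close> in
  \<open>G\<close> to its derived subgroup \<open>K\<close> in the transfer kernel \<open>N\<close>.
  The factor \<open>|F:K|\<close> lost in this passage equals \<open>|G:N|\<close> and is restored
  by the Frattini argument. Since the ambient group changes, \<open>G\<close> is a variable of the
  induction and not a fixed locale.\<close>

lemma malnormal_card_dvd_normalizer:
  fixes G :: "('a, 'b) monoid_scheme"
  assumes "group G" "finite (carrier G)" "malnormal F G" "hypoabelian F G"
    and r: "Factorial_Ring.prime r" "\<not> r dvd card F"
    and R: "subgroup R G" "card R = r ^ k" "\<not> r dvd card (rcosets\<^bsub>G\<^esub> R)"
  shows "card F dvd card (normalizer G R)"
  using assms
proof (induction "card F" arbitrary: F G rule: less_induct)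
  case less
  interpret group G by fact
  note fin = less.prems(2)
  note mal = less.prems(3)
  note R = less.prems(7-9)
  have F: "subgroup F G"
    using mal by (simp add: malnormal_def)
  show ?case
  proof (cases "F = {\<one>\<^bsub>G\<^esub>}")
    case True
    then show ?thesis by simp
  next
    case False
    define K where "K = derived G F"
    have "K \<noteq> F"
      using less.prems(4) F False by (auto simp: hypoabelian_def K_def)
    have K: "subgroup K G" "K \<subseteq> F"
      unfolding K_def using F subgroup.subset[OF F] derived_is_subgroup derived_incl by auto
    have finF: "finite F"
      using fin F subgroup.subset finite_subset by blast
    have K_less: "card K < card F"
      using K(2) \<open>K \<noteq> F\<close> finF by (simp add: psubset_card_mono psubset_eq)
    obtain N where N: "N \<lhd> G" "N \<inter> F = K" "card (rcosets\<^bsub>G\<^esub> N) * card K = card F"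
      using malnormal_transfer_kernel[OF fin mal] K_def by metis
    interpret N: normal N G by fact
    interpret GN: group "G\<lparr>carrier := N\<rparr>"
      using N.is_subgroup by (rule subgroup_imp_group)
    have "\<not> r dvd card (rcosets\<^bsub>G\<^esub> N)" "\<not> r dvd card K"
      using less.prems(6) N(3) by (metis dvd_mult2, metis dvd_mult)
    \<comment> \<open>The index of \<open>N\<close> divides \<open>|F|\<close>, hence is prime to
      \<open>r\<close>, while every element of \<open>R\<close> has order a power of
      \<open>r\<close>.\<close>
    have "R \<subseteq> N"
    proof
      fix x assume x: "x \<in> R"
      then have "x [^]\<^bsub>G\<^esub> (r ^ k) \<in> N"
        using pow_card_subgroup[OF R(1)] R(2) N.one_closed by simp
      moreover have "x [^]\<^bsub>G\<^esub> card (rcosets\<^bsub>G\<^esub> N) \<in> N"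
        using x R(1) N(1) subgroup.subset by (blast intro: pow_index_normal)
      moreover have "coprime (r ^ k) (card (rcosets\<^bsub>G\<^esub> N))"
        using \<open>\<not> r dvd card (rcosets\<^bsub>G\<^esub> N)\<close> r(1) by (simp add: prime_imp_coprime)
      ultimately show "x \<in> N"
        using x R(1) subgroup.subset N.is_subgroup by (blast intro: pow_mem_subgroup_coprime)
    qed
    have R_N: "subgroup R (G\<lparr>carrier := N\<rparr>)"
      using R \<open>R \<subseteq> N\<close> N.is_subgroup by (simp add: subgroup_incl)
    have index: "\<not> r dvd card (rcosets\<^bsub>G\<lparr>carrier := N\<rparr>\<^esub> R)"
    proof -
      have "card (rcosets\<^bsub>G\<lparr>carrier := N\<rparr>\<^esub> R) * card R = card N"
        using GN.lagrange[OF R_N] by (simp add: order_def)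
      moreover have "card (rcosets\<^bsub>G\<^esub> R) * card R = order G" "card (rcosets\<^bsub>G\<^esub> N) * card N = order G"
        using lagrange R(1) N.is_subgroup by auto
      ultimately have "card (rcosets\<^bsub>G\<^esub> R) * card R = (card (rcosets\<^bsub>G\<^esub> N) * card (rcosets\<^bsub>G\<lparr>carrier := N\<rparr>\<^esub> R)) * card R"
        by (metis mult.assoc)
      moreover have "card R \<noteq> 0"
        using R(2) r(1) by auto
      ultimately have "card (rcosets\<^bsub>G\<^esub> R) = card (rcosets\<^bsub>G\<^esub> N) * card (rcosets\<^bsub>G\<lparr>carrier := N\<rparr>\<^esub> R)"
        by simp
      then show ?thesis
        using R(3) by (metis dvd_mult)
    qed
    \<comment> \<open>Inherited because \<open>K\<close> is the full intersection of
      \<open>N\<close> and \<open>F\<close>: a conjugating element of \<open>N\<close> lies in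
      \<open>F\<close>, hence in \<open>K\<close>.\<close>
    have "malnormal K (G\<lparr>carrier := N\<rparr>)"
      unfolding malnormal_def
    proof (intro conjI ballI impI)
      show "subgroup K (G\<lparr>carrier := N\<rparr>)"
        using K N(2) N.is_subgroup by (intro subgroup_incl) auto
      fix g f assume gf: "g \<in> carrier (G\<lparr>carrier := N\<rparr>)" "f \<in> K" "f \<noteq> \<one>\<^bsub>G\<lparr>carrier := N\<rparr>\<^esub>"
        "inv\<^bsub>G\<lparr>carrier := N\<rparr>\<^esub> g \<otimes>\<^bsub>G\<lparr>carrier := N\<rparr>\<^esub> f \<otimes>\<^bsub>G\<lparr>carrier := N\<rparr>\<^esub> g \<in> K"
      have "inv\<^bsub>G\<^esub> g \<otimes>\<^bsub>G\<^esub> f \<otimes>\<^bsub>G\<^esub> g \<in> F" "f \<in> F" "f \<noteq> \<one>\<^bsub>G\<^esub>" "g \<in> carrier G"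
        using gf K(2) N.is_subgroup N.mem_carrier by auto
      then have "g \<in> F"
        using mal unfolding malnormal_def by blast
      then show "g \<in> K"
        using gf(1) N(2) by auto
    qed
    moreover have "hypoabelian K (G\<lparr>carrier := N\<rparr>)"
      unfolding hypoabelian_def
    proof (intro allI impI)
      fix U assume U: "subgroup U (G\<lparr>carrier := N\<rparr>)" "U \<subseteq> K" "derived (G\<lparr>carrier := N\<rparr>) U = U"
      then have "derived G U = U" "subgroup U G" "U \<subseteq> F"
        using K(2) N(2) N.is_subgroup derived_consistent[of U N] incl_subgroup by auto
      then show "U = {\<one>\<^bsub>G\<lparr>carrier := N\<rparr>\<^esub>}"
        using less.prems(4) by (auto simp: hypoabelian_def)
    qed
    moreover have "finite N"
      using fin N.subset finite_subset by blast
    ultimately have "card K dvd card (normalizer (G\<lparr>carrier := N\<rparr>) R)"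
      using less.hyps[OF K_less] GN.is_group r(1) \<open>\<not> r dvd card K\<close> R_N R(2) index by simp
    then have "card K dvd card (normalizer G R \<inter> N)"
      using normalizer_consistent[OF N.is_subgroup \<open>R \<subseteq> N\<close>] by simp
    then have "card (rcosets\<^bsub>G\<^esub> N) * card K dvd card (normalizer G R)"
      using frattini[OF fin N(1) r(1) R(1) \<open>R \<subseteq> N\<close> R(2) index] by (simp add: mult_dvd_mono)
    then show ?thesis
      using N(3) by simp
  qed
qed

subsection \<open>Fixed-point-free action\<close>

lemma prime_power_if_unique_prime_factor:
  assumes "(n::nat) \<noteq> 0" "Factorial_Ring.prime q"
    and "\<And>s. \<lbrakk>Factorial_Ring.prime s; s dvd n\<rbrakk> \<Longrightarrow> s = q"
  obtains k where "n = q ^ k"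
proof -
  obtain m where m: "n = q ^ multiplicity q n * m" "\<not> q dvd m"
    using multiplicity_decompose'[OF assms(1), of q] assms(2) by (metis not_prime_unit)
  have "m = 1"
    using m assms(3) prime_factor_nat[of m] by (metis dvd_mult)
  then show ?thesis
    using m(1) that by simp
qed

lemma (in comm_monoid) finprod_lessThan_Suc:
  assumes "f \<in> {..n::nat} \<rightarrow> carrier G"
  shows "finprod G f {..<Suc n} = f n \<otimes> finprod G f {..<n}"
  using assms by (auto simp: lessThan_Suc intro!: finprod_insert)

text \<open>Both sides are the product of \<open>f 0\<close> up to \<open>f n\<close>, with either
  the last or the first factor split off.\<close>

lemma (in comm_monoid) finprod_shift:
  assumes "\<And>i::nat. f i \<in> carrier G"
  shows "f n \<otimes> finprod G f {..<n} = f 0 \<otimes> finprod G (\<lambda>i. f (Suc i)) {..<n}"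
  by (induction n) (use assms in \<open>simp_all add: finprod_lessThan_Suc Pi_iff m_lcomm\<close>)

lemma (in comm_monoid) finprod_swap:
  assumes "\<And>i j. f i j \<in> carrier G"
  shows "finprod G (\<lambda>i. finprod G (f i) {..<m}) {..<n::nat}
    = finprod G (\<lambda>j. finprod G (\<lambda>i. f i j) {..<n}) {..<m::nat}"
proof (induction n)
  case (Suc n)
  have "finprod G (\<lambda>i. finprod G (f i) {..<m}) {..<Suc n}
      = finprod G (f n) {..<m} \<otimes> finprod G (\<lambda>j. finprod G (\<lambda>i. f i j) {..<n}) {..<m}"
    using Suc assms by (simp add: finprod_lessThan_Suc Pi_iff)
  also have "\<dots> = finprod G (\<lambda>j. f n j \<otimes> finprod G (\<lambda>i. f i j) {..<n}) {..<m}"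
    using assms by (subst finprod_multf) (simp_all add: Pi_iff)
  also have "\<dots> = finprod G (\<lambda>j. finprod G (\<lambda>i. f i j) {..<Suc n}) {..<m}"
    using assms by (intro finprod_cong') (simp_all add: finprod_lessThan_Suc Pi_iff)
  finally show ?case .
qed simp

section \<open>Norms under automorphisms without fixed points\<close>

context group
begin

lemma comm_group_abelian_subgroup:
  assumes "subgroup Z G" "\<And>a b. \<lbrakk>a \<in> Z; b \<in> Z\<rbrakk> \<Longrightarrow> a \<otimes> b = b \<otimes> a"
  shows "comm_group (G\<lparr>carrier := Z\<rparr>)"
  using assms by (intro group.group_comm_groupI subgroup_imp_group) auto

text \<open>Conjugation by \<open>w\<close> permutes the factors cyclically, as
  \<open>w [^] q = \<one>\<close>, so the product is a fixed point of \<open>w\<close> in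
  \<open>Z\<close>.\<close>

lemma fixed_point_free_norm:
  assumes Z: "subgroup Z G" "\<And>a b. \<lbrakk>a \<in> Z; b \<in> Z\<rbrakk> \<Longrightarrow> a \<otimes> b = b \<otimes> a"
    and w: "w \<in> carrier G" "w [^] (q::nat) = \<one>" "\<And>a. a \<in> Z \<Longrightarrow> conj_by w a \<in> Z"
    and fpf: "\<And>a. \<lbrakk>a \<in> Z; conj_by w a = a\<rbrakk> \<Longrightarrow> a = \<one>"
    and b: "b \<in> Z"
  shows "finprod (G\<lparr>carrier := Z\<rparr>) (\<lambda>i. conj_by (w [^] i) b) {..<q} = \<one>"
proof -
  interpret Z: comm_group "G\<lparr>carrier := Z\<rparr>"
    using Z by (rule comm_group_abelian_subgroup)
  note Zs = subgroup.subset[OF Z(1)]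
  have bG: "b \<in> carrier G"
    using b Zs by blast
  define f where "f i = conj_by (w [^] i) b" for i :: nat
  have f_Suc: "conj_by w (f i) = f (Suc i)" for i
    using w(1) bG by (simp add: f_def mult_conj_by)
  have f_Z: "f i \<in> Z" for i
  proof (induction i)
    case (Suc i)
    then show ?case
      using f_Suc w(3) by metis
  qed (use b bG in \<open>simp add: f_def\<close>)
  have prod_Z: "finprod (G\<lparr>carrier := Z\<rparr>) g {..<n} \<in> Z" if "\<And>i. g i \<in> Z" for g and n :: nat
    using Z.finprod_closed[of g "{..<n}"] that by auto
  have conj_prod: "conj_by w (finprod (G\<lparr>carrier := Z\<rparr>) f {..<n})
      = finprod (G\<lparr>carrier := Z\<rparr>) (\<lambda>i. f (Suc i)) {..<n}" for n
  proof (induction n)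
    case (Suc n)
    have "conj_by w (finprod (G\<lparr>carrier := Z\<rparr>) f {..<Suc n})
        = conj_by w (f n \<otimes> finprod (G\<lparr>carrier := Z\<rparr>) f {..<n})"
      using f_Z by (subst Z.finprod_lessThan_Suc) auto
    also have "\<dots> = f (Suc n) \<otimes> conj_by w (finprod (G\<lparr>carrier := Z\<rparr>) f {..<n})"
      using w(1) f_Z prod_Z[of f n] Zs by (simp add: conj_by_mult f_Suc subset_iff)
    also have "\<dots> = finprod (G\<lparr>carrier := Z\<rparr>) (\<lambda>i. f (Suc i)) {..<Suc n}"
      unfolding Suc using f_Z by (subst Z.finprod_lessThan_Suc) auto
    finally show ?case .
  qed (use w(1) in simp)
  have "f q = f 0"
    using w(1,2) by (simp add: f_def)
  then have "finprod (G\<lparr>carrier := Z\<rparr>) f {..<q} = finprod (G\<lparr>carrier := Z\<rparr>) (\<lambda>i. f (Suc i)) {..<q}"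
    using Z.finprod_shift[of f q] f_Z prod_Z[of f q] prod_Z[of "\<lambda>i. f (Suc i)" q] Zs
    by (auto simp: subset_iff)
  then have "conj_by w (finprod (G\<lparr>carrier := Z\<rparr>) f {..<q}) = finprod (G\<lparr>carrier := Z\<rparr>) f {..<q}"
    using conj_prod by metis
  then show ?thesis
    using fpf prod_Z[of f q] f_Z by (simp add: f_def[abs_def])
qed

text \<open>
  Multiplying the trivial norms of \<open>a\<close> along the subgroups generated by the \<open>u v\<^sup>j\<close> and cancelling
  trivial norms along the subgroup generated by \<open>v\<close> leaves \<open>a\<^sup>q\<close>.
\<close>

lemma fixed_point_free_elementary_abelian:
  assumes q: "Factorial_Ring.prime (q::nat)"
    and Z: "subgroup Z G" "\<And>a b. \<lbrakk>a \<in> Z; b \<in> Z\<rbrakk> \<Longrightarrow> a \<otimes> b = b \<otimes> a"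
    and uv: "u \<in> carrier G" "v \<in> carrier G" "u \<otimes> v = v \<otimes> u" "u [^] q = \<one>" "v [^] q = \<one>" "v \<noteq> \<one>"
    and indep: "\<And>j::nat. u \<otimes> v [^] j \<noteq> \<one>"
    and inv: "\<And>a. a \<in> Z \<Longrightarrow> conj_by u a \<in> Z" "\<And>a. a \<in> Z \<Longrightarrow> conj_by v a \<in> Z"
    and fpf: "\<And>(i::nat) (j::nat) a. \<lbrakk>u [^] i \<otimes> v [^] j \<noteq> \<one>; a \<in> Z; conj_by (u [^] i \<otimes> v [^] j) a = a\<rbrakk> \<Longrightarrow> a = \<one>"
    and a: "a \<in> Z"
  shows "a [^] q = \<one>"
proof -
  interpret Z: comm_group "G\<lparr>carrier := Z\<rparr>"
    using Z by (rule comm_group_abelian_subgroup)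
  note Zs = subgroup.subset[OF Z(1)]
  have aG: "a \<in> carrier G"
    using a Zs by blast
  have inv_pow: "conj_by (w [^] i) b \<in> Z" if "\<And>a. a \<in> Z \<Longrightarrow> conj_by w a \<in> Z" "w \<in> carrier G" "b \<in> Z"
    for w b and i :: nat
    by (induction i) (use that Zs in \<open>auto simp: mult_conj_by subset_iff\<close>)
  have comm_pow: "u \<otimes> v [^] j = v [^] j \<otimes> u" for j :: nat
    using uv(1-3) by (metis group_commutes_pow)
  \<comment> \<open>For fixed \<open>j\<close> the conjugating elements are the powers of
    \<open>u \<otimes> v [^] j\<close>; for fixed \<open>i\<close> they are the powers of
    \<open>v [^] i\<close>, shifted by \<open>u [^] i\<close>. The square of values is multiplied
    out once by rows and once by columns.\<close>
  define f where "f i j = conj_by (u [^] i \<otimes> v [^] (i * j)) a" for i j :: nat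
  have f_Z: "f i j \<in> Z" for i j
    unfolding f_def using uv(1,2) aG a inv by (simp add: mult_conj_by inv_pow)
  have row: "finprod (G\<lparr>carrier := Z\<rparr>) (\<lambda>i. f i j) {..<q} = \<one>" for j
  proof -
    define w where "w = u \<otimes> v [^] j"
    have wG: "w \<in> carrier G"
      using uv by (simp add: w_def)
    have w_pow: "w [^] i = u [^] i \<otimes> v [^] (i * j)" for i :: nat
      unfolding w_def using uv(1,2) pow_mult_distrib[OF comm_pow[of j]]
      by (simp add: nat_pow_pow mult.commute)
    have "finprod (G\<lparr>carrier := Z\<rparr>) (\<lambda>i. conj_by (w [^] i) a) {..<q} = \<one>"
    proof (rule fixed_point_free_norm[OF Z wG])
      show "w [^] q = \<one>"
        using uv by (simp add: w_pow nat_pow_pow[symmetric])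
      show "conj_by w b \<in> Z" if "b \<in> Z" for b
        using that uv(1,2) inv inv_pow[of v] Zs by (auto simp: w_def mult_conj_by subset_iff)
      show "b = \<one>" if "b \<in> Z" "conj_by w b = b" for b
        using fpf[of 1 j b] that indep uv(1) by (simp add: w_def)
    qed (use a in auto)
    then show ?thesis
      by (simp add: f_def w_pow)
  qed
  have col: "finprod (G\<lparr>carrier := Z\<rparr>) (f i) {..<q} = (if i = 0 then a [^] q else \<one>)" if i: "i < q" for i
  proof (cases "i = 0")
    case True
    then have "f i = (\<lambda>_. a)"
      using uv(2) aG by (simp add: f_def fun_eq_iff)
    then show ?thesis
      using True Z.finprod_const[of a "{..<q}"] a by (simp flip: nat_pow_consistent)
  next
    case False
    define w where "w = v [^] i"
    have wG: "w \<in> carrier G"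
      using uv by (simp add: w_def)
    \<comment> \<open>Together with \<open>0 < i < q\<close> this makes \<open>v [^] i\<close>
      nontrivial, so that it has no fixed points either. Only the column \<open>i = 0\<close>, where
      every entry is \<open>a\<close>, escapes.\<close>
    have "ord v = q"
      using uv(2,5,6) q by (metis ord_eq_1 pow_eq_id prime_nat_iff)
    then have "w \<noteq> \<one>"
      using uv(2) False i by (auto simp: w_def pow_eq_id dest: dvd_imp_le)
    have "finprod (G\<lparr>carrier := Z\<rparr>) (\<lambda>j. conj_by (w [^] j) (conj_by (u [^] i) a)) {..<q} = \<one>"
    proof (rule fixed_point_free_norm[OF Z wG])
      show "w [^] q = \<one>"
        using uv by (metis w_def nat_pow_pow nat_pow_one mult.commute)
      show "conj_by w b \<in> Z" if "b \<in> Z" for b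
        using that uv(2) inv inv_pow[of v] by (simp add: w_def)
      show "b = \<one>" if "b \<in> Z" "conj_by w b = b" for b
        using fpf[of 0 i b] that uv(2) \<open>w \<noteq> \<one>\<close> by (simp add: w_def)
    qed (use a uv(1) inv inv_pow[of u] in auto)
    moreover have "f i = (\<lambda>j. conj_by (w [^] j) (conj_by (u [^] i) a))"
      using uv(1,2) aG by (simp add: f_def w_def fun_eq_iff mult_conj_by nat_pow_pow)
    ultimately show ?thesis
      using False by simp
  qed
  have "\<one> = finprod (G\<lparr>carrier := Z\<rparr>) (\<lambda>j. finprod (G\<lparr>carrier := Z\<rparr>) (\<lambda>i. f i j) {..<q}) {..<q}"
    using row Z.finprod_one[of "{..<q}"] by simp
  also have "\<dots> = finprod (G\<lparr>carrier := Z\<rparr>) (\<lambda>i. finprod (G\<lparr>carrier := Z\<rparr>) (f i) {..<q}) {..<q}"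
    using Z.finprod_swap[of f q q] f_Z by simp
  also have "\<dots> = finprod (G\<lparr>carrier := Z\<rparr>) (\<lambda>i. if 0 = i then a [^] q else \<one>\<^bsub>G\<lparr>carrier := Z\<rparr>\<^esub>) {..<q}"
    using col Z(1) a by (intro Z.finprod_cong') (auto simp: subgroup.one_closed subgroup_nat_pow_closed)
  also have "\<dots> = a [^] q"
    using Z.finprod_singleton[of 0 "{..<q}" "\<lambda>_. a [^] q"] q Z(1) a prime_gt_0_nat
    by (simp add: subgroup_nat_pow_closed)
  finally show ?thesis by simp
qed

text \<open>By Cauchy's theorem a second prime divisor of the order would give an element of that
  prime order, against the exponent \<open>q\<close>.\<close>

lemma exponent_prime_imp_card_power:
  assumes "finite (carrier G)" "Factorial_Ring.prime q" "subgroup Q G" "\<And>x. x \<in> Q \<Longrightarrow> x [^] q = \<one>"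
  obtains k where "card Q = q ^ k"
proof -
  have "card Q \<noteq> 0"
    using assms(1,3) subgroup.subset subgroup.one_closed by (metis card_0_eq empty_iff finite_subset)
  then show ?thesis
  proof (rule prime_power_if_unique_prime_factor[OF _ assms(2)])
    fix s assume s: "Factorial_Ring.prime s" "s dvd card Q"
    then obtain x where x: "x \<in> Q" "x \<noteq> \<one>" "x [^] s = \<one>"
      using exists_prime_order_subgroup[OF assms(1) s(1) assms(3)] by blast
    have xG: "x \<in> carrier G"
      using x(1) assms(3) subgroup.subset by blast
    show "s = q"
    proof (rule ccontr)
      assume "s \<noteq> q"
      then have "coprime s q"
        using s(1) assms(2) primes_coprime by blast
      then have "x \<in> {\<one>}"
        using pow_mem_subgroup_coprime[OF triv_subgroup xG, of s q] x assms(4) by simp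
      then show False
        using x(2) by simp
    qed
  qed (use that in blast)
qed

text \<open>If \<open>u\<close> were no power of \<open>v\<close>, a conjugate of the group
  generated by both would act without fixed points on the centre of a Sylow
  \<open>r\<close>-subgroup; the norm identity then gives that centre exponent dividing
  \<open>q\<close>, although \<open>r\<close> differs from \<open>q\<close>.\<close>

lemma malnormal_no_elementary_abelian:
  assumes fin: "finite (carrier G)" and mal: "malnormal F G" "hypoabelian F G" and proper: "F \<noteq> carrier G"
    and q: "Factorial_Ring.prime (q::nat)"
    and uv: "u \<in> F" "v \<in> F" "u \<otimes> v = v \<otimes> u" "u [^] q = \<one>" "v [^] q = \<one>" "v \<noteq> \<one>"
  shows "\<exists>j::nat. u \<otimes> v [^] j = \<one>"
proof (rule ccontr)
  assume indep: "\<nexists>j::nat. u \<otimes> v [^] j = \<one>"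
  have F: "subgroup F G"
    and mal': "\<And>g f. \<lbrakk>g \<in> carrier G; f \<in> F; f \<noteq> \<one>; conj_by g f \<in> F\<rbrakk> \<Longrightarrow> g \<in> F"
    using mal(1) by (auto simp: malnormal_iff)
  note Fs = subgroup.subset[OF F]
  have uvG: "u \<in> carrier G" "v \<in> carrier G"
    using uv Fs by auto
  have lag: "card (rcosets F) * card F = order G"
    using lagrange F by simp
  have "card (rcosets F) \<noteq> 1"
    using lag proper Fs fin by (metis card_subset_eq mult_1 order_def)
  \<comment> \<open>A prime divisor of the index of \<open>F\<close> cannot divide
    \<open>|F|\<close>, and it does divide \<open>|G|\<close>; so its Sylow subgroup
    \<open>R\<close> is nontrivial and of order prime to \<open>|F|\<close>.\<close>
  then obtain r where r: "Factorial_Ring.prime r" "r dvd card (rcosets F)"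
    using prime_factor_nat by blast
  have rF: "\<not> r dvd card F"
    using malnormal_index_coprime[OF fin mal(1) r(1)] r(2) by blast
  have "order G \<noteq> 0"
    using fin order_gt_0_iff_finite by simp
  then obtain m where m: "order G = r ^ multiplicity r (order G) * m" "\<not> r dvd m"
    using multiplicity_decompose'[of "order G" r] r(1) by (metis not_prime_unit)
  define k where "k = multiplicity r (order G)"
  obtain R where R: "subgroup R G" "card R = r ^ k"
    using Sylow.sylow_thm[OF r(1) is_group _ fin] m(1) k_def by blast
  note Rs = subgroup.subset[OF R(1)]
  have "card (rcosets R) = m"
  proof -
    have "card (rcosets R) * r ^ k = m * r ^ k"
      using lagrange[OF R(1)] R(2) m(1) k_def by (metis mult.commute)
    then show ?thesis
      using r(1) by auto
  qed
  then have R_index: "\<not> r dvd card (rcosets R)"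
    using m(2) by simp
  have "k \<noteq> 0"
    using r(2) lag m k_def by (metis dvd_mult2 mult_1 power_0)
  then have "card R \<noteq> 1"
    using R(2) prime_gt_1_nat[OF r(1)] by simp
  then have "R \<noteq> {\<one>}"
    by auto
  define M where "M = normalizer G R"
  have M: "subgroup M G"
    unfolding M_def using Rs by (rule normalizer_imp_subgroup)
  have "card F dvd card M"
    unfolding M_def using malnormal_card_dvd_normalizer[OF is_group fin mal r(1) rF R R_index] .
  then have "card (rcosets M) dvd card (rcosets F)"
  proof -
    obtain d where d: "card M = card F * d"
      using \<open>card F dvd card M\<close> by blast
    have "card (rcosets F) * card F = (card (rcosets M) * d) * card F"
      using lagrange[OF M] lag d by (simp add: mult_ac)
    moreover have "card F \<noteq> 0"
      using lag \<open>order G \<noteq> 0\<close> by (metis mult_0_right)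
    ultimately show ?thesis by simp
  qed
  moreover have "q dvd card F"
  proof -
    have "ord v = q"
      using uvG uv(5,6) q by (metis ord_eq_1 pow_eq_id prime_nat_iff)
    then show ?thesis
      using pow_card_subgroup[OF F uv(2)] uvG by (simp add: pow_eq_id)
  qed
  ultimately have M_index: "\<not> q dvd card (rcosets M)"
    using malnormal_index_coprime[OF fin mal(1) q] dvd_trans by blast
  \<comment> \<open>As \<open>u\<close> and \<open>v\<close> commute, this is the subgroup they
    generate.\<close>
  define Q where "Q = {u [^] i \<otimes> v [^] j | (i::nat) (j::nat). True}"
  have comm: "u [^] i \<otimes> v [^] j = v [^] j \<otimes> u [^] i" for i j :: nat
    using uvG uv(3) by (metis group_commutes_pow nat_pow_closed)
  have Q_mult: "(u [^] i \<otimes> v [^] j) \<otimes> (u [^] i' \<otimes> v [^] j') = u [^] (i + i') \<otimes> v [^] (j + j')" for i j i' j' :: nat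
  proof -
    have "(u [^] i \<otimes> v [^] j) \<otimes> (u [^] i' \<otimes> v [^] j') = u [^] i \<otimes> (v [^] j \<otimes> u [^] i') \<otimes> v [^] j'"
      using uvG by (simp add: m_assoc)
    also have "\<dots> = u [^] i \<otimes> (u [^] i' \<otimes> v [^] j) \<otimes> v [^] j'"
      using comm by simp
    finally show ?thesis
      using uvG by (simp add: m_assoc flip: nat_pow_mult)
  qed
  have pow_q: "u [^] (i * q) = \<one>" "v [^] (i * q) = \<one>" for i :: nat
    using uvG uv(4,5) by (metis mult.commute nat_pow_one nat_pow_pow)+
  have Q_sub: "subgroup Q G"
  proof (rule subgroupI)
    show "Q \<subseteq> carrier G" "Q \<noteq> {}"
      using uvG by (auto simp: Q_def)
    show "x \<otimes> y \<in> Q" if "x \<in> Q" "y \<in> Q" for x y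
      using that by (clarsimp simp: Q_def Q_mult) blast
    show "inv x \<in> Q" if x: "x \<in> Q" for x
    proof -
      obtain i j :: nat where ij: "x = u [^] i \<otimes> v [^] j"
        using x by (auto simp: Q_def)
      have "i * (q - 1) + i = i * q" "j * (q - 1) + j = j * q"
        using prime_gt_0_nat[OF q] by (metis Suc_diff_1 add.commute mult_Suc_right)+
      then have "u [^] (i * (q - 1)) \<otimes> v [^] (j * (q - 1)) \<otimes> x = \<one>"
        unfolding ij Q_mult by (simp add: pow_q)
      then have "inv x = u [^] (i * (q - 1)) \<otimes> v [^] (j * (q - 1))"
        using uvG by (intro inv_equality) (auto simp: ij)
      then show ?thesis
        by (auto simp: Q_def)
    qed
  qed
  have "x [^] q = \<one>" if "x \<in> Q" for x
    using that uvG comm by (auto simp: Q_def pow_mult_distrib nat_pow_pow pow_q)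
  then obtain l where l: "card Q = q ^ l"
    using exponent_prime_imp_card_power[OF fin q Q_sub] by blast
  obtain g where g: "g \<in> carrier G" "Q \<subseteq> conj_set G M g"
    using p_subgroup_in_conjugate[OF fin q Q_sub l M M_index] by blast
  define s where "s = conj_by (inv g) u"
  define t where "t = conj_by (inv g) v"
  have stG: "s \<in> carrier G" "t \<in> carrier G"
    using uvG g by (simp_all add: s_def t_def)
  have "u \<in> Q" "v \<in> Q"
    unfolding Q_def using uvG by (force intro: exI[of _ 1] exI[of _ 0])+
  then have stM: "s \<in> M" "t \<in> M"
    using g uvG subgroup.subset[OF M] by (auto simp: s_def t_def mem_conj_set_iff subset_iff)
  have st_pow: "s [^] i \<otimes> t [^] j = conj_by (inv g) (u [^] i \<otimes> v [^] j)" for i j :: nat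
    using uvG g by (simp add: s_def t_def conj_by_mult conj_by_pow)
  \<comment> \<open>The norm identities need an abelian group on which \<open>s\<close> and
    \<open>t\<close> act; the centre of \<open>R\<close> is invariant under the whole normalizer
    \<open>M\<close>.\<close>
  define Z where "Z = {a \<in> R. \<forall>x\<in>R. x \<otimes> a = a \<otimes> x}"
  have RG [simp]: "x \<in> carrier G" if "x \<in> R" for x
    using that Rs by blast
  have Z_sub: "subgroup Z G"
  proof (rule subgroupI)
    show "Z \<subseteq> carrier G" "Z \<noteq> {}"
      using subgroup.one_closed[OF R(1)] by (auto simp: Z_def)
    show "inv a \<in> Z" if "a \<in> Z" for a
      using that subgroup.m_inv_closed[OF R(1)] by (auto simp: Z_def commute_inv)
    show "a \<otimes> b \<in> Z" if ab: "a \<in> Z" "b \<in> Z" for a b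
    proof -
      have abR: "a \<in> R" "b \<in> R"
        using ab by (simp_all add: Z_def)
      have "x \<otimes> (a \<otimes> b) = a \<otimes> b \<otimes> x" if x: "x \<in> R" for x
      proof -
        have "x \<otimes> a = a \<otimes> x" "x \<otimes> b = b \<otimes> x"
          using ab x by (simp_all add: Z_def)
        then show ?thesis
          using abR x by (metis RG m_assoc)
      qed
      then show ?thesis
        using abR subgroup.m_closed[OF R(1)] by (simp add: Z_def)
    qed
  qed
  have Z_inv: "conj_by w a \<in> Z" if w: "w \<in> M" and a: "a \<in> Z" for w a
  proof -
    have wG: "w \<in> carrier G"
      using w M subgroup.subset by blast
    have aR: "a \<in> R"
      using a by (simp add: Z_def)
    have "x \<otimes> conj_by w a = conj_by w a \<otimes> x" if x: "x \<in> R" for x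
    proof -
      have "conj_by (inv w) x \<in> R"
        using w x Rs subgroup.m_inv_closed[OF M w] conj_by_normalizer_mem_iff[of R "inv w" x]
        by (simp add: M_def)
      then have "conj_by w (conj_by (inv w) x \<otimes> a) = conj_by w (a \<otimes> conj_by (inv w) x)"
        using a by (simp add: Z_def)
      then show ?thesis
        using wG x aR by (simp add: conj_by_mult)
    qed
    moreover have "conj_by w a \<in> R"
      using w aR Rs conj_by_normalizer_mem_iff[of R w a] by (simp add: M_def)
    ultimately show ?thesis
      by (simp add: Z_def)
  qed
  \<comment> \<open>A fixed \<open>a\<close> has a conjugate that commutes with a nontrivial
    \<open>w\<close> in \<open>F\<close>. Malnormality puts this conjugate into \<open>F\<close>,
    where its order, a power of \<open>r\<close>, must be 1.\<close>
  have fpf: "a = \<one>" if w: "s [^] i \<otimes> t [^] j \<noteq> \<one>" and a: "a \<in> Z"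
    and fix_a: "conj_by (s [^] i \<otimes> t [^] j) a = a" for i j :: nat and a
  proof -
    define w where "w = u [^] i \<otimes> v [^] j"
    have wF: "w \<in> F"
      unfolding w_def using uv(1,2) F by (simp add: subgroup.m_closed subgroup_nat_pow_closed)
    have wG: "w \<in> carrier G" and aG: "a \<in> carrier G"
      using wF Fs a by (auto simp: Z_def)
    have "w \<noteq> \<one>"
      using w g by (auto simp: st_pow w_def)
    have "conj_by (inv g) w \<otimes> a = a \<otimes> conj_by (inv g) w"
      using fix_a conj_by_fixed_iff[of "conj_by (inv g) w" a] g wG aG by (simp add: st_pow w_def)
    then have "conj_by g (conj_by (inv g) w \<otimes> a) = conj_by g (a \<otimes> conj_by (inv g) w)"
      by simp
    then have "w \<otimes> conj_by g a = conj_by g a \<otimes> w"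
      using g wG aG by (simp add: conj_by_mult)
    then have "conj_by (conj_by g a) w \<in> F"
      using conj_by_fixed_iff[of "conj_by g a" w] g wG aG wF by simp
    then have "conj_by g a \<in> F"
      using mal'[of "conj_by g a" w] wF \<open>w \<noteq> \<one>\<close> g aG by simp
    then have "conj_by g a [^] card F \<in> {\<one>}"
      using pow_card_subgroup[OF F] by simp
    moreover have "conj_by g a [^] (r ^ k) \<in> {\<one>}"
      using pow_card_subgroup[OF R(1), of a] R(2) a g aG by (simp add: Z_def flip: conj_by_pow)
    moreover have "coprime (r ^ k) (card F)"
      using rF r(1) by (simp add: prime_imp_coprime)
    ultimately have "conj_by g a \<in> {\<one>}"
      using pow_mem_subgroup_coprime[OF triv_subgroup] g aG by (metis conj_by_closed)
    then show ?thesis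
      using g aG by simp
  qed
  obtain a where a: "a \<in> R" "a \<noteq> \<one>" "\<And>x. x \<in> R \<Longrightarrow> x \<otimes> a = a \<otimes> x"
    using p_group_center_nontrivial[OF r(1) R \<open>R \<noteq> {\<one>}\<close>] by blast
  then have aZ: "a \<in> Z"
    by (simp add: Z_def)
  have "a [^] q = \<one>"
  proof (rule fixed_point_free_elementary_abelian[OF q Z_sub _ stG])
    show "x \<otimes> y = y \<otimes> x" if "x \<in> Z" "y \<in> Z" for x y
      using that unfolding Z_def by blast
    show "conj_by s x \<in> Z" "conj_by t x \<in> Z" if "x \<in> Z" for x
      using that stM Z_inv by blast+
    show "x = \<one>" if "s [^] i \<otimes> t [^] j \<noteq> \<one>" "x \<in> Z" "conj_by (s [^] i \<otimes> t [^] j) x = x" for i j :: nat and x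
      using that by (rule fpf)
    show "s \<otimes> t = t \<otimes> s"
      using uv(3) uvG g by (simp add: s_def t_def flip: conj_by_mult)
    show "s [^] q = \<one>" "t [^] q = \<one>" "t \<noteq> \<one>"
      using uv(4-6) uvG g by (simp_all add: s_def t_def flip: conj_by_pow)
    show "s \<otimes> t [^] j \<noteq> \<one>" for j :: nat
      using st_pow[of 1 j] indep uvG g stG by simp
  qed (rule aZ)
  moreover have "a [^] (r ^ k) = \<one>"
    using pow_card_subgroup[OF R(1) a(1)] R(2) by simp
  moreover have "coprime (r ^ k) q"
  proof -
    have "r \<noteq> q"
      using rF \<open>q dvd card F\<close> by blast
    then show ?thesis
      using r(1) q primes_coprime coprime_power_left_iff by blast
  qed
  ultimately have "a \<in> {\<one>}"
    using pow_mem_subgroup_coprime[OF triv_subgroup, of a "r ^ k" q] a(1) by simp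
  then show False
    using a(2) by simp
qed

text \<open>Induction on the exponent of the order of \<open>h\<close>. Once \<open>h [^] q\<close>
  is the \<open>q\<close>-th power of a power of \<open>c\<close>, dividing \<open>h\<close> by that
  power leaves \<open>u\<close> with \<open>u [^] q = \<one>\<close>; comparing \<open>u\<close>
  with the element \<open>v\<close> of order \<open>q\<close> in the group of \<open>c\<close>
  brings \<open>h\<close> into that group.\<close>

lemma commuting_prime_power_elements_comparable:
  assumes fin: "finite (carrier G)" and q: "Factorial_Ring.prime q" and F: "subgroup F G"
    and no_elem: "\<And>u v. \<lbrakk>u \<in> F; v \<in> F; u \<otimes> v = v \<otimes> u; u [^] q = \<one>; v [^] q = \<one>; v \<noteq> \<one>\<rbrakk>
      \<Longrightarrow> \<exists>j::nat. u \<otimes> v [^] j = \<one>"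
    and c: "c \<in> F" "ord c = q ^ a"
    and h: "h \<in> F" "ord h = q ^ b" and comm: "h \<otimes> c = c \<otimes> h" and "b \<le> a"
  shows "h \<in> generate G {c}"
  using h comm \<open>b \<le> a\<close>
proof (induction b arbitrary: h)
  case 0
  then have "h = \<one>"
    using subgroup.subset[OF F] ord_eq_1[of h] by auto
  then show ?case
    by (simp add: generate.one)
next
  case (Suc b)
  note Fs = subgroup.subset[OF F]
  have cG: "c \<in> carrier G" and hG: "h \<in> carrier G"
    using c(1) Suc.prems(1) Fs by auto
  have gen: "subgroup (generate G {c}) G"
    using cG by (intro generate_is_subgroup) simp
  have gen_pow: "generate G {c} = {c [^] k | k. k \<in> (UNIV :: nat set)}"
    using fin cG by (rule generate_pow_on_finite_carrier)
  have q0: "q > 0"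
    using q prime_gt_0_nat by blast
  have "ord (h [^] q) = q ^ b"
    using ord_pow[OF hG, of q] Suc.prems(2) q0 by simp
  moreover have "h [^] q \<otimes> c = c \<otimes> h [^] q"
    using hG cG Suc.prems(3) by (metis group_commutes_pow)
  ultimately have "h [^] q \<in> generate G {c}"
    using Suc.IH[of "h [^] q"] Suc.prems F by (simp add: subgroup_nat_pow_closed)
  then obtain j :: nat where j: "h [^] q = c [^] j"
    by (auto simp: gen_pow)
  \<comment> \<open>This is where \<open>Suc b \<le> a\<close> enters: \<open>q ^ a\<close> divides
    \<open>j * q ^ b\<close>, hence so does \<open>q ^ Suc b\<close>.\<close>
  have "q dvd j"
  proof -
    have "c [^] (j * q ^ b) = h [^] (q ^ Suc b)"
      using j hG cG by (simp flip: nat_pow_pow)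
    also have "\<dots> = \<one>"
      using hG Suc.prems(2) by (simp add: pow_eq_id)
    finally have "q ^ a dvd j * q ^ b"
      using cG c(2) by (simp add: pow_eq_id)
    moreover have "q ^ Suc b dvd q ^ a"
      using Suc.prems(4) by (rule le_imp_power_dvd)
    ultimately have "q * q ^ b dvd j * q ^ b"
      using dvd_trans by (metis power_Suc)
    then show ?thesis
      using q0 by simp
  qed
  then obtain k where k: "j = k * q"
    by (metis dvd_div_mult_self)
  define u where "u = h \<otimes> inv (c [^] k)"
  define v where "v = c [^] (q ^ (a - 1))"
  have comm_k: "h \<otimes> inv (c [^] k) = inv (c [^] k) \<otimes> h"
  proof -
    have "h \<otimes> c [^] k = c [^] k \<otimes> h"
      using hG cG Suc.prems(3) by (metis group_commutes_pow)
    then show ?thesis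
      using hG cG commute_inv by simp
  qed
  have "u [^] q = h [^] q \<otimes> inv (c [^] k) [^] q"
    unfolding u_def using hG cG by (intro pow_mult_distrib comm_k) simp_all
  also have "\<dots> = \<one>"
    using cG by (simp add: j k nat_pow_inv nat_pow_pow)
  finally have uq: "u [^] q = \<one>" .
  have "a \<noteq> 0"
    using Suc.prems(4) by simp
  then have a_eq: "q ^ a = q ^ (a - 1) * q"
    by (metis One_nat_def Suc_pred mult.commute neq0_conv power_Suc)
  then have "v [^] q = \<one>"
    using cG c(2) by (simp add: v_def nat_pow_pow pow_eq_id)
  moreover have "v \<noteq> \<one>"
  proof
    assume "v = \<one>"
    then have "q ^ a dvd q ^ (a - 1)"
      using cG c(2) by (simp add: v_def pow_eq_id)
    then have "q dvd 1"
      using a_eq q0 by simp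
    then show False
      using q not_prime_unit by blast
  qed
  moreover have "u \<in> F" "v \<in> F"
    using F c(1) Suc.prems(1)
    by (simp_all add: u_def v_def subgroup.m_closed subgroup.m_inv_closed subgroup_nat_pow_closed)
  moreover have "u \<otimes> v = v \<otimes> u"
  proof -
    have "h \<otimes> v = v \<otimes> h"
      unfolding v_def using hG cG Suc.prems(3) by (metis group_commutes_pow)
    moreover have "inv (c [^] k) \<otimes> v = v \<otimes> inv (c [^] k)"
    proof -
      have "c [^] k \<otimes> v = v \<otimes> c [^] k"
        unfolding v_def using cG by (simp add: nat_pow_mult add.commute)
      then show ?thesis
        using cG v_def commute_inv by simp
    qed
    moreover have "v \<in> carrier G"
      using cG v_def by simp
    ultimately show ?thesis
      unfolding u_def using hG cG by (metis inv_closed m_assoc nat_pow_closed)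
  qed
  ultimately obtain i :: nat where "u \<otimes> v [^] i = \<one>"
    using no_elem uq by blast
  then have "u = inv (v [^] i)"
    using hG cG by (simp add: inv_equality u_def v_def)
  moreover have "h = u \<otimes> c [^] k"
    using hG cG by (simp add: u_def m_assoc)
  ultimately have "h = inv (v [^] i) \<otimes> c [^] k"
    by simp
  moreover have "c [^] n \<in> generate G {c}" for n :: nat
    by (auto simp: gen_pow)
  ultimately show ?case
    using gen by (simp add: v_def subgroup.m_closed subgroup.m_inv_closed subgroup_nat_pow_closed)
qed

end

subsection \<open>Normalizing subgroups\<close>

context group
begin

lemma subgroup_set_mult:
  assumes N: "subgroup N G" and E: "subgroup E G"
    and norm: "\<And>e n. \<lbrakk>e \<in> E; n \<in> N\<rbrakk> \<Longrightarrow> conj_by e n \<in> N"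
  shows "subgroup (N <#> E) G"
proof (rule subgroupI)
  note NG [simp] = subgroup.mem_carrier[OF N] and EG [simp] = subgroup.mem_carrier[OF E]
  show "N <#> E \<subseteq> carrier G"
    by (auto simp: set_mult_def)
  show "N <#> E \<noteq> {}"
    using subgroup.one_closed[OF N] subgroup.one_closed[OF E] by (auto simp: set_mult_def)
  show "inv x \<in> N <#> E" if x: "x \<in> N <#> E" for x
  proof -
    obtain n e where ne: "n \<in> N" "e \<in> E" "x = n \<otimes> e"
      using x by (auto simp: set_mult_def)
    have "inv x = conj_by e (inv n) \<otimes> inv e"
      using ne by (simp add: conj_by_def inv_mult_group m_assoc)
    moreover have "conj_by e (inv n) \<in> N" "inv e \<in> E"
      using ne N E norm by (auto simp: subgroup.m_inv_closed)
    ultimately show ?thesis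
      by (auto simp: set_mult_def)
  qed
  show "x \<otimes> y \<in> N <#> E" if xy: "x \<in> N <#> E" "y \<in> N <#> E" for x y
  proof -
    obtain n e n' e' where ne: "n \<in> N" "e \<in> E" "x = n \<otimes> e" "n' \<in> N" "e' \<in> E" "y = n' \<otimes> e'"
      using xy by (auto simp: set_mult_def)
    have "x \<otimes> y = (n \<otimes> conj_by (inv e) n') \<otimes> (e \<otimes> e')"
      using ne by (simp add: conj_by_def m_assoc)
    moreover have "n \<otimes> conj_by (inv e) n' \<in> N" "e \<otimes> e' \<in> E"
      using ne N E norm by (auto simp: subgroup.m_inv_closed subgroup.m_closed)
    ultimately show ?thesis
      by (auto simp: set_mult_def)
  qed
qed

lemma set_mult_superset:
  assumes "subgroup N G" "subgroup E G"
  shows "N \<subseteq> N <#> E" "E \<subseteq> N <#> E"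
proof -
  show "N \<subseteq> N <#> E"
    using subgroup.one_closed[OF assms(2)] subgroup.mem_carrier[OF assms(1)]
    by (force simp: set_mult_def)
  show "E \<subseteq> N <#> E"
    using subgroup.one_closed[OF assms(1)] subgroup.mem_carrier[OF assms(2)]
    by (force simp: set_mult_def)
qed

lemma subgroup_centralizer:
  assumes "S \<subseteq> carrier G"
  shows "subgroup (centralizer G S) G"
proof (rule subgroupI)
  show "centralizer G S \<subseteq> carrier G" "centralizer G S \<noteq> {}"
    using assms by (auto simp: centralizer_def subset_iff)
  show "inv a \<in> centralizer G S" if "a \<in> centralizer G S" for a
    using that assms by (auto simp: centralizer_def subset_iff commute_inv)
  show "a \<otimes> b \<in> centralizer G S" if "a \<in> centralizer G S" "b \<in> centralizer G S" for a b
    using that assms by (auto simp: centralizer_def subset_iff) (metis m_assoc)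
qed

lemma normal_in_subgroupI:
  assumes "subgroup H G" "subgroup K G" "H \<subseteq> K"
    and "\<And>k h. \<lbrakk>k \<in> K; h \<in> H\<rbrakk> \<Longrightarrow> conj_by k h \<in> H"
  shows "H \<lhd> G\<lparr>carrier := K\<rparr>"
proof -
  interpret K: group "G\<lparr>carrier := K\<rparr>"
    using assms(2) by (rule subgroup_imp_group)
  have "k \<otimes> h \<otimes> inv k \<in> H" if "k \<in> K" "h \<in> H" for k h
    using assms(4)[of "inv k" h] that assms(2) subgroup.mem_carrier[OF assms(2)]
    by (simp add: conj_by_def subgroup.m_inv_closed)
  then show ?thesis
    using assms(1-3) by (auto simp: K.normal_inv_iff subgroup_incl)
qed

text \<open>Modulo the abelian group \<open>B\<close>, the group \<open>F\<close> is a product of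
  abelian normal subgroups. A largest good subgroup \<open>N\<close> absorbs each of them, because
  the commutators of \<open>N <#> E\<close> fall into \<open>N\<close>.\<close>

lemma hypoabelianI:
  assumes fin: "finite (carrier G)" and F: "subgroup F G"
    and B: "subgroup B G" "B \<subseteq> F" "\<And>f b. \<lbrakk>f \<in> F; b \<in> B\<rbrakk> \<Longrightarrow> conj_by f b \<in> B"
      "\<And>a b. \<lbrakk>a \<in> B; b \<in> B\<rbrakk> \<Longrightarrow> a \<otimes> b = b \<otimes> a"
    and ex: "\<And>y. y \<in> F \<Longrightarrow> \<exists>E. subgroup E G \<and> E \<subseteq> F \<and> y \<in> E \<and> (\<forall>f\<in>F. \<forall>e\<in>E. conj_by f e \<in> E)
      \<and> (\<forall>a\<in>E. \<forall>b\<in>E. a \<otimes> b \<otimes> inv a \<otimes> inv b \<in> B)"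
  shows "hypoabelian F G"
proof -
  define good where "good N \<longleftrightarrow> subgroup N G \<and> B \<subseteq> N \<and> N \<subseteq> F \<and> (\<forall>f\<in>F. \<forall>n\<in>N. conj_by f n \<in> N)
    \<and> hypoabelian N G" for N
  note FG [simp] = subgroup.mem_carrier[OF F]
  have finF: "finite F"
    using fin subgroup.subset[OF F] finite_subset by blast
  \<comment> \<open>A perfect subgroup of \<open>M\<close> equals its own derived subgroup and so
    already lies in \<open>N\<close>.\<close>
  have perfect_sub: "hypoabelian M G"
    if "hypoabelian N G" "subgroup N G"
      and comm: "\<And>a b. \<lbrakk>a \<in> M; b \<in> M\<rbrakk> \<Longrightarrow> a \<otimes> b \<otimes> inv a \<otimes> inv b \<in> N" for M N
    unfolding hypoabelian_def
  proof (intro allI impI)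
    fix U assume U: "subgroup U G" "U \<subseteq> M" "derived G U = U"
    have "derived G U \<subseteq> N"
      unfolding derived_def using that(2) U(2) comm by (intro generate_subgroup_incl) auto
    then show "U = {\<one>}"
      using U that(1) by (auto simp: hypoabelian_def)
  qed
  have "hypoabelian {\<one>} G"
    using subgroup.one_closed by (fastforce simp: hypoabelian_def)
  then have "hypoabelian B G"
  proof (rule perfect_sub[OF _ triv_subgroup])
    fix a b assume ab: "a \<in> B" "b \<in> B"
    have "a \<otimes> b \<otimes> inv a \<otimes> inv b = b \<otimes> a \<otimes> inv a \<otimes> inv b"
      using B(4)[OF ab] by simp
    also have "\<dots> = \<one>"
      using ab subgroup.mem_carrier[OF B(1)] by (simp add: m_assoc)
    finally show "a \<otimes> b \<otimes> inv a \<otimes> inv b \<in> {\<one>}" by simp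
  qed
  then have "good B"
    using B by (simp add: good_def)
  moreover have "\<forall>N. good N \<longrightarrow> card N \<le> card F"
    using finF by (auto simp: good_def intro: card_mono)
  ultimately obtain N where N: "good N" "\<And>N'. good N' \<Longrightarrow> card N' \<le> card N"
    using ex_has_greatest_nat[of good B card "Suc (card F)"] by (auto simp: less_Suc_eq_le)
  have NG: "subgroup N G" and norm: "\<And>f n. \<lbrakk>f \<in> F; n \<in> N\<rbrakk> \<Longrightarrow> conj_by f n \<in> N"
    and NF: "N \<subseteq> F" and BN: "B \<subseteq> N" and hypN: "hypoabelian N G"
    using N(1) by (auto simp: good_def)
  have "y \<in> N" if y: "y \<in> F" for y
  proof (rule ccontr)
    assume "y \<notin> N"
    obtain E where E: "subgroup E G" "E \<subseteq> F" "y \<in> E" "\<And>f e. \<lbrakk>f \<in> F; e \<in> E\<rbrakk> \<Longrightarrow> conj_by f e \<in> E"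
      and comm: "\<And>a b. \<lbrakk>a \<in> E; b \<in> E\<rbrakk> \<Longrightarrow> a \<otimes> b \<otimes> inv a \<otimes> inv b \<in> B"
      using ex[OF y] by blast
    have NEG [simp]: "x \<in> carrier G" if "x \<in> N \<or> x \<in> E" for x
      using that NF E(2) by auto
    define M where "M = N <#> E"
    have "good M"
      unfolding good_def
    proof (intro conjI ballI)
      show "subgroup M G"
        unfolding M_def using NG E(1,2) norm by (intro subgroup_set_mult) auto
      show "B \<subseteq> M"
        unfolding M_def using BN set_mult_superset(1)[OF NG E(1)] by blast
      show "M \<subseteq> F"
        unfolding M_def using NF E(2) F by (auto simp: set_mult_def subgroup.m_closed subset_iff)
      show "conj_by f m \<in> M" if "f \<in> F" "m \<in> M" for f m
        using that norm E(4) by (fastforce simp: M_def set_mult_def conj_by_mult)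
      show "hypoabelian M G"
      proof (rule perfect_sub[OF hypN NG])
        fix a b assume "a \<in> M" "b \<in> M"
        then obtain n e n' e' where ne: "n \<in> N" "e \<in> E" "a = n \<otimes> e" "n' \<in> N" "e' \<in> E" "b = n' \<otimes> e'"
          by (auto simp: M_def set_mult_def)
        have "a \<otimes> b \<otimes> inv a \<otimes> inv b = n \<otimes> conj_by (inv e) n' \<otimes> (e \<otimes> e' \<otimes> inv e \<otimes> inv e')
            \<otimes> conj_by (inv e') (inv n) \<otimes> inv n'"
          using ne by (simp add: conj_by_def inv_mult_group m_assoc)
        moreover have "e \<otimes> e' \<otimes> inv e \<otimes> inv e' \<in> N"
          using comm ne BN by blast
        moreover have "conj_by (inv e) n' \<in> N" "conj_by (inv e') (inv n) \<in> N"
          using ne NG E(1,2) norm by (auto simp: subgroup.m_inv_closed subset_iff)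
        ultimately show "a \<otimes> b \<otimes> inv a \<otimes> inv b \<in> N"
          using ne NG by (simp add: subgroup.m_closed subgroup.m_inv_closed)
      qed
    qed
    then have "card M \<le> card N" "M \<subseteq> F"
      using N(2) by (auto simp: good_def)
    moreover have "N \<subset> M"
      unfolding M_def using set_mult_superset[OF NG E(1)] E(3) \<open>y \<notin> N\<close> by blast
    ultimately show False
      using finF psubset_card_mono[of M N] finite_subset by fastforce
  qed
  then have "F = N"
    using NF by blast
  then show ?thesis
    using hypN by simp
qed

text \<open>The witness \<open>E\<close> is the preimage in \<open>W\<close> of the centre of
  \<open>W\<close> modulo \<open>B\<close>, written with commutators to avoid quotients. It is
  invariant under \<open>F\<close> since \<open>W\<close> and \<open>B\<close> are.\<close>

lemma central_mod_abelian_normal: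
  assumes F: "subgroup F G"
    and B: "subgroup B G" "B \<subseteq> F" "\<And>f b. \<lbrakk>f \<in> F; b \<in> B\<rbrakk> \<Longrightarrow> conj_by f b \<in> B"
    and W: "subgroup W G" "W \<subseteq> F" "\<And>f w. \<lbrakk>f \<in> F; w \<in> W\<rbrakk> \<Longrightarrow> conj_by f w \<in> W"
    and y: "y \<in> W" "\<And>w. w \<in> W \<Longrightarrow> y \<otimes> w \<otimes> inv y \<otimes> inv w \<in> B"
  shows "\<exists>E. subgroup E G \<and> E \<subseteq> F \<and> y \<in> E \<and> (\<forall>f\<in>F. \<forall>e\<in>E. conj_by f e \<in> E)
      \<and> (\<forall>a\<in>E. \<forall>b\<in>E. a \<otimes> b \<otimes> inv a \<otimes> inv b \<in> B)"
proof -
  define E where "E = {w \<in> W. \<forall>v\<in>W. w \<otimes> v \<otimes> inv w \<otimes> inv v \<in> B}"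
  note FG [simp] = subgroup.mem_carrier[OF F]
  note WG [simp] = subgroup.mem_carrier[OF W(1)]
  have WF: "w \<in> F" if "w \<in> W" for w
    using that W(2) by blast
  have "subgroup E G"
  proof (rule subgroupI)
    show "E \<subseteq> carrier G"
      by (auto simp: E_def)
    show "E \<noteq> {}"
      using y by (auto simp: E_def)
    show "inv a \<in> E" if a: "a \<in> E" for a
    proof -
      have aW: "a \<in> W"
        using a by (simp add: E_def)
      have "inv a \<otimes> v \<otimes> inv (inv a) \<otimes> inv v \<in> B" if v: "v \<in> W" for v
      proof -
        have "inv a \<otimes> v \<otimes> inv (inv a) \<otimes> inv v = conj_by a (inv (a \<otimes> v \<otimes> inv a \<otimes> inv v))"
          using aW v by (simp add: conj_by_def inv_mult_group m_assoc)
        then show ?thesis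
          using a v aW B(1,3) WF by (simp add: E_def subgroup.m_inv_closed)
      qed
      then show ?thesis
        using aW W(1) by (simp add: E_def subgroup.m_inv_closed)
    qed
    show "a \<otimes> b \<in> E" if ab: "a \<in> E" "b \<in> E" for a b
    proof -
      have abW: "a \<in> W" "b \<in> W"
        using ab by (simp_all add: E_def)
      have "(a \<otimes> b) \<otimes> v \<otimes> inv (a \<otimes> b) \<otimes> inv v \<in> B" if v: "v \<in> W" for v
      proof -
        have "(a \<otimes> b) \<otimes> v \<otimes> inv (a \<otimes> b) \<otimes> inv v
            = conj_by (inv a) (b \<otimes> v \<otimes> inv b \<otimes> inv v) \<otimes> (a \<otimes> v \<otimes> inv a \<otimes> inv v)"
          using abW v by (simp add: conj_by_def inv_mult_group m_assoc)
        moreover have "inv a \<in> F"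
          using abW WF F by (simp add: subgroup.m_inv_closed)
        ultimately show ?thesis
          using ab v B(1,3) by (simp add: E_def subgroup.m_closed)
      qed
      then show ?thesis
        using abW W(1) by (simp add: E_def subgroup.m_closed)
    qed
  qed
  moreover have "conj_by f e \<in> E" if f: "f \<in> F" and e: "e \<in> E" for f e
  proof -
    have eW: "e \<in> W"
      using e by (simp add: E_def)
    have "conj_by f e \<otimes> v \<otimes> inv (conj_by f e) \<otimes> inv v \<in> B" if v: "v \<in> W" for v
    proof -
      define u where "u = conj_by (inv f) v"
      have u: "u \<in> W"
        unfolding u_def using f v F W(3) by (simp add: subgroup.m_inv_closed)
      have v_eq: "v = conj_by f u"
        using f v by (simp add: u_def)
      have "conj_by f e \<otimes> v \<otimes> inv (conj_by f e) \<otimes> inv v = conj_by f (e \<otimes> u \<otimes> inv e \<otimes> inv u)"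
        unfolding v_eq using f eW u by (simp add: conj_by_mult conj_by_inv)
      then show ?thesis
        using e u f B(3) by (simp add: E_def)
    qed
    then show ?thesis
      using f eW W(3) by (simp add: E_def)
  qed
  moreover have "E \<subseteq> F" "y \<in> E"
    using W(2) y by (auto simp: E_def)
  moreover have "a \<otimes> b \<otimes> inv a \<otimes> inv b \<in> B" if "a \<in> E" "b \<in> E" for a b
    using that by (simp add: E_def)
  ultimately show ?thesis by blast
qed

end

subsection \<open>The complement is hypoabelian\<close>

text \<open>Climb the subnormal chain: whatever normalizes a nontrivial subgroup of \<open>F\<close>
  conjugates some nontrivial element of \<open>F\<close> into \<open>F\<close>, hence lies in
  \<open>F\<close>. So every member of the chain, up to \<open>G\<close>, stays inside
  \<open>F\<close>.\<close>

lemma subnormal_in_malnormal: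
  assumes "subnormal U G" "group G" "malnormal F G" "U \<subseteq> F" "U \<noteq> {\<one>\<^bsub>G\<^esub>}"
  shows "F = carrier G"
  using assms
proof (induction rule: subnormal.induct)
  case (top G)
  then show ?case
    by (auto simp: malnormal_def dest: subgroup.subset)
next
  case (step K G H)
  interpret group G by fact
  have F: "subgroup F G"
    and mal: "\<And>g f. \<lbrakk>g \<in> carrier G; f \<in> F; f \<noteq> \<one>\<^bsub>G\<^esub>; conj_by g f \<in> F\<rbrakk> \<Longrightarrow> g \<in> F"
    using step.prems(2) by (auto simp: malnormal_iff)
  have K: "K \<subseteq> carrier G"
    using step.hyps(1) subgroup_self by (cases rule: subnormal.cases) (auto dest: subgroup.subset)
  have Ksub: "subgroup K G"
    using step.hyps(1) subgroup_self by (cases rule: subnormal.cases) auto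
  obtain h where h: "h \<in> H" "h \<noteq> \<one>\<^bsub>G\<^esub>"
    using step.prems(4) subgroup.one_closed[OF step.hyps(2)] by blast
  have "K \<subseteq> F"
  proof
    fix k assume k: "k \<in> K"
    have "inv\<^bsub>G\<lparr>carrier := K\<rparr>\<^esub> k \<otimes>\<^bsub>G\<lparr>carrier := K\<rparr>\<^esub> h \<otimes>\<^bsub>G\<lparr>carrier := K\<rparr>\<^esub> k \<in> H"
      using normal.inv_op_closed1[OF step.hyps(4), of k h] k h(1) by simp
    then have "conj_by k h \<in> F"
      using k Ksub step.prems(3) by (auto simp: conj_by_def)
    then show "k \<in> F"
      using mal[of k h] k K h step.prems(3) by blast
  qed
  moreover have "K \<noteq> {\<one>\<^bsub>G\<^esub>}"
    using h step.hyps(3) by blast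
  ultimately show ?case
    using step.IH step.prems by blast
qed

context group
begin

text \<open>\<open>A\<close> is a nontrivial \<open>F\<close>-invariant set centralizing
  \<open>x\<close>, later the centre of \<open>L\<close>. It makes the centralizer \<open>C\<close>
  of \<open>x\<close> normal in \<open>F\<close>; the centre \<open>B\<close> of \<open>C\<close> is
  then an abelian normal subgroup, and each \<open>y\<close> in \<open>F\<close> is placed in a
  normal subgroup that is abelian modulo \<open>B\<close>.\<close>

lemma malnormal_hypoabelian:
  assumes fin: "finite (carrier G)" and mal: "malnormal F G" and proper: "F \<noteq> carrier G"
    and p: "Factorial_Ring.prime p"
    and hyp: "\<And>V. \<lbrakk>self_centralizing V G; p dvd card V\<rbrakk> \<Longrightarrow> TI_subgroup V G \<or> subnormal V G"
    and x: "x \<in> F" "x \<noteq> \<one>" "x [^] p = \<one>"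
    and z: "z \<in> A" "z \<noteq> \<one>" and A: "A \<subseteq> F" "\<And>f a. \<lbrakk>f \<in> F; a \<in> A\<rbrakk> \<Longrightarrow> conj_by f a \<in> A"
      "\<And>a. a \<in> A \<Longrightarrow> a \<otimes> x = x \<otimes> a"
  shows "hypoabelian F G"
proof -
  have F: "subgroup F G"
    and mal': "\<And>g f. \<lbrakk>g \<in> carrier G; f \<in> F; f \<noteq> \<one>; conj_by g f \<in> F\<rbrakk> \<Longrightarrow> g \<in> F"
    using mal by (auto simp: malnormal_iff)
  note FG [simp] = subgroup.mem_carrier[OF F]
  have centralizer_F: "g \<in> F" if "g \<in> carrier G" "g \<otimes> f = f \<otimes> g" "f \<in> F" "f \<noteq> \<one>" for g f
    using that mal'[of g f] conj_by_fixed_iff[of g f] by simp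
  have "ord x = p"
    using x p by (metis FG ord_eq_1 pow_eq_id prime_nat_iff)
  then have p_dvd: "p dvd card V" if "subgroup V G" "x \<in> V" for V
    using pow_card_subgroup[OF that] x(1) by (simp add: pow_eq_id)
  \<comment> \<open>Containing \<open>x\<close> brings \<open>V\<close> under the hypothesis, lying
    in \<open>F\<close> rules out subnormality, and TI then needs only the single element
    \<open>b\<close>.\<close>
  have normal_F: "conj_by f v \<in> V"
    if V: "self_centralizing V G" "V \<subseteq> F" "x \<in> V"
      and b: "b \<in> V" "b \<noteq> \<one>" "conj_by f b \<in> V" and f: "f \<in> F" and v: "v \<in> V" for V b f v
  proof -
    have sub: "subgroup V G"
      using V(1) by (simp add: self_centralizing_def)
    have "\<not> subnormal V G"
      using subnormal_in_malnormal[OF _ is_group mal V(2)] proper x(2) V(3) by blast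
    then have "TI_subgroup V G"
      using hyp V p_dvd sub by blast
    moreover have "finite V"
      using fin subgroup.subset[OF sub] finite_subset by blast
    ultimately have "f \<in> normalizer G V"
      using TI_subgroupD[of V f b] b f by simp
    then show ?thesis
      using conj_by_normalizer_mem_iff[of V f v] v subgroup.subset[OF sub] subgroup.mem_carrier[OF sub]
      by simp
  qed
  define C where "C = centralizer G {x}"
  have C: "subgroup C G"
    unfolding C_def using x(1) by (intro subgroup_centralizer) simp
  have xC: "x \<in> C"
    using x(1) by (simp add: C_def centralizer_def)
  have CF: "C \<subseteq> F"
    using centralizer_F x(1,2) by (auto simp: C_def centralizer_def)
  have "self_centralizing C G"
    using C xC by (auto simp: self_centralizing_def C_def centralizer_def)
  moreover have "A \<subseteq> C"
    using A(1,3) by (auto simp: C_def centralizer_def)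
  ultimately have C_normal: "conj_by f v \<in> C" if "f \<in> F" "v \<in> C" for f v
    using normal_F[of C z f v] that CF xC z A(2) by blast
  define B where "B = centralizer G C"
  have B: "subgroup B G"
    unfolding B_def using subgroup.subset[OF C] by (rule subgroup_centralizer)
  have BC: "B \<subseteq> C"
    using xC by (auto simp: B_def C_def centralizer_def)
  have xB: "x \<in> B"
    using x(1) by (auto simp: B_def C_def centralizer_def)
  have BF: "B \<subseteq> F"
    using BC CF by blast
  have B_abelian: "a \<otimes> b = b \<otimes> a" if "a \<in> B" "b \<in> B" for a b
    using that BC by (auto simp: B_def centralizer_def)
  have B_normal: "conj_by f b \<in> B" if f: "f \<in> F" and b: "b \<in> B" for f b
  proof -
    have bF: "b \<in> F"
      using b BF by blast
    have "conj_by f b \<otimes> v = v \<otimes> conj_by f b" if v: "v \<in> C" for v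
    proof -
      have vF: "v \<in> F"
        using v CF by blast
      have "conj_by (inv f) v \<in> C"
        using C_normal f v F by (simp add: subgroup.m_inv_closed)
      then have "conj_by f (b \<otimes> conj_by (inv f) v) = conj_by f (conj_by (inv f) v \<otimes> b)"
        using b by (simp add: B_def centralizer_def)
      then show ?thesis
        using f bF vF by (simp add: conj_by_mult)
    qed
    then show ?thesis
      using f bF by (simp add: B_def centralizer_def)
  qed
  show ?thesis
  proof (rule hypoabelianI[OF fin F B BF B_normal B_abelian])
    fix y assume y: "y \<in> F"
    define Y where "Y = generate G {y}"
    have Y: "subgroup Y G"
      unfolding Y_def using y by (intro generate_is_subgroup) simp
    have YF: "Y \<subseteq> F"
      unfolding Y_def using y F by (intro generate_subgroup_incl) auto
    have yY: "y \<in> Y"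
      by (simp add: Y_def generate.incl)
    have Y_comm: "y \<otimes> w = w \<otimes> y" if "w \<in> Y" for w
    proof -
      have "Y \<subseteq> centralizer G {y}"
        unfolding Y_def using y
        by (intro generate_subgroup_incl subgroup_centralizer) (auto simp: centralizer_def)
      then show ?thesis
        using that by (auto simp: centralizer_def)
    qed
    define T where "T = B <#> Y"
    have T: "subgroup T G"
      unfolding T_def using B Y YF B_normal by (intro subgroup_set_mult) auto
    have TF: "T \<subseteq> F"
      unfolding T_def using BF YF F by (auto simp: set_mult_def subgroup.m_closed subset_iff)
    have BT: "B \<subseteq> T" and YT: "Y \<subseteq> T"
      unfolding T_def using set_mult_superset[OF B Y] by auto
    define D where "D = centralizer G T"
    have D: "subgroup D G"
      unfolding D_def using subgroup.subset[OF T] by (rule subgroup_centralizer)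
    have DF: "D \<subseteq> F"
      using centralizer_F[of _ x] x(1,2) xB BT by (auto simp: D_def centralizer_def)
    \<comment> \<open>Adjoining its centralizer makes \<open>T\<close> self-centralizing: what
      centralizes \<open>W\<close> centralizes \<open>T\<close>, so it lies in
      \<open>D\<close>.\<close>
    define W where "W = T <#> D"
    have W: "subgroup W G"
      unfolding W_def
    proof (rule subgroup_set_mult[OF T D])
      fix d u assume "d \<in> D" "u \<in> T"
      then show "conj_by d u \<in> T"
        using conj_by_fixed_iff[of d u] subgroup.mem_carrier[OF T] by (auto simp: D_def centralizer_def)
    qed
    have TW: "T \<subseteq> W" and DW: "D \<subseteq> W"
      unfolding W_def using set_mult_superset[OF T D] by auto
    have WF: "W \<subseteq> F"
      unfolding W_def using TF DF F by (auto simp: set_mult_def subgroup.m_closed subset_iff)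
    have "self_centralizing W G"
      unfolding self_centralizing_def
    proof
      have "centralizer G W \<subseteq> D"
        using TW by (auto simp: D_def centralizer_def)
      then show "centralizer G W \<subseteq> W"
        using DW by blast
    qed (rule W)
    moreover have xW: "x \<in> W"
      using xB BT TW by blast
    ultimately have W_normal: "conj_by f w \<in> W" if "f \<in> F" "w \<in> W" for f w
      using normal_F[of W x f w] that WF x(2) B_normal[OF that(1) xB] BT TW by blast
    \<comment> \<open>The factors of \<open>w\<close> from \<open>Y\<close> and \<open>D\<close>
      commute with \<open>y\<close>, so only the factor from the normal subgroup \<open>B\<close>
      contributes to the commutator.\<close>
    have "y \<otimes> w \<otimes> inv y \<otimes> inv w \<in> B" if w: "w \<in> W" for w
    proof -
      obtain b t d where *: "b \<in> B" "t \<in> Y" "d \<in> D" "w = b \<otimes> t \<otimes> d"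
        using w by (auto simp: W_def T_def set_mult_def)
      have carr: "b \<in> carrier G" "t \<in> carrier G" "d \<in> carrier G" "y \<in> carrier G"
        using * BF YF DF y by auto
      have "d \<otimes> y = y \<otimes> d"
        using *(3) yY YT by (auto simp: D_def centralizer_def)
      then have comm: "(t \<otimes> d) \<otimes> y = y \<otimes> (t \<otimes> d)"
        using Y_comm[OF *(2)] carr by (metis m_assoc)
      then have "(t \<otimes> d) \<otimes> inv y = inv y \<otimes> (t \<otimes> d)"
        using carr commute_inv[of y "t \<otimes> d"] by simp
      then have "y \<otimes> w \<otimes> inv y \<otimes> inv w = y \<otimes> b \<otimes> (inv y \<otimes> (t \<otimes> d)) \<otimes> inv w"
        using carr *(4) by (simp add: m_assoc)
      also have "\<dots> = conj_by (inv y) b \<otimes> inv b"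
        using carr *(4) by (simp add: conj_by_def inv_mult_group m_assoc)
      also have "\<dots> \<in> B"
        using * y F B B_normal by (simp add: subgroup.m_inv_closed subgroup.m_closed)
      finally show ?thesis .
    qed
    then show "\<exists>E. subgroup E G \<and> E \<subseteq> F \<and> y \<in> E \<and> (\<forall>f\<in>F. \<forall>e\<in>E. conj_by f e \<in> E)
        \<and> (\<forall>a\<in>E. \<forall>b\<in>E. a \<otimes> b \<otimes> inv a \<otimes> inv b \<in> B)"
      using yY YT TW by (intro central_mod_abelian_normal[OF F B BF B_normal W WF W_normal]) auto
  qed
qed

end

subsection \<open>Maximal counterexamples\<close>

context group
begin

lemma ord_conj_by:
  assumes "g \<in> carrier G" "c \<in> carrier G"
  shows "ord (conj_by g c) = ord c"
proof -
  have "conj_by g c [^] n = \<one> \<longleftrightarrow> c [^] n = \<one>" for n :: nat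
    using assms by (simp flip: conj_by_pow)
  then show ?thesis
    using assms by (meson conj_by_closed dvd_antisym dvd_refl pow_eq_id)
qed

text \<open>Take \<open>c\<close> of least order in \<open>K\<close> outside \<open>H\<close>. Then
  \<open>c [^] s\<close> is in \<open>H\<close> for each prime \<open>s\<close> dividing the order,
  and two different such primes would put \<open>c\<close> itself into \<open>H\<close>.\<close>

lemma exists_prime_power_element_outside:
  assumes fin: "finite (carrier G)" and H: "subgroup H G" and K: "subgroup K G" "\<not> K \<subseteq> H"
  obtains c q a where "c \<in> K" "c \<notin> H" "Factorial_Ring.prime q" "ord c = q ^ a" "c [^] q \<in> H"
proof -
  obtain c0 where "c0 \<in> K \<and> c0 \<notin> H"
    using K(2) by blast
  then obtain c where c: "c \<in> K" "c \<notin> H" and min: "\<And>d. \<lbrakk>d \<in> K; d \<notin> H\<rbrakk> \<Longrightarrow> ord c \<le> ord d"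
    using ex_has_least_nat[of "\<lambda>c. c \<in> K \<and> c \<notin> H" c0 ord] by blast
  have cG: "c \<in> carrier G"
    using c(1) K(1) by (rule subgroup.mem_carrier[rotated])
  have ord_pos: "ord c \<noteq> 0"
    using ord_ge_1[OF fin cG] by simp
  have pow_H: "c [^] s \<in> H" if s: "Factorial_Ring.prime s" "s dvd ord c" for s
  proof (rule ccontr)
    assume "c [^] s \<notin> H"
    then have "ord c \<le> ord (c [^] s)"
      using min K(1) c(1) by (simp add: subgroup_nat_pow_closed)
    also have "\<dots> = ord c div s"
      using ord_pow[OF cG s(2)] s(1) by auto
    also have "\<dots> < ord c"
      using ord_pos prime_gt_1_nat[OF s(1)] by simp
    finally show False by simp
  qed
  have "c \<noteq> \<one>"
    using c(2) subgroup.one_closed[OF H] by blast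
  then have "ord c \<noteq> 1"
    using cG ord_eq_1 by metis
  then obtain q where q: "Factorial_Ring.prime q" "q dvd ord c"
    using prime_factor_nat by blast
  have "s = q" if s: "Factorial_Ring.prime s" "s dvd ord c" for s
  proof (rule ccontr)
    assume "s \<noteq> q"
    then have "coprime s q"
      using s(1) q(1) primes_coprime by blast
    then show False
      using pow_mem_subgroup_coprime[OF H cG, of s q] pow_H s q c(2) by blast
  qed
  then obtain a where a: "ord c = q ^ a"
    using prime_power_if_unique_prime_factor[OF ord_pos q(1)] by blast
  show ?thesis
    using that[OF c q(1) a pow_H[OF q]] .
qed

text \<open>
  If \<open>m\<close> normalizes \<open>normalizer G L\<close> but moves \<open>L\<close>, then \<open>L\<close> and its conjugate by \<open>m\<close> commute
  elementwise and intersect trivially, and \<open>g\<close> normalizes both \<open>L\<close> and the product of \<open>H\<close> with this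
  conjugate, hence their intersection \<open>H\<close>.
\<close>

lemma malnormal_normalizer_TI:
  assumes fin: "finite (carrier G)"
    and H: "subgroup H G" and L: "subgroup L G" "H \<subseteq> L" "TI_subgroup L G" "L \<noteq> {\<one>}"
    and g: "g \<in> normalizer G L" "g \<notin> normalizer G H" and h: "h \<in> H" "h \<noteq> \<one>" "conj_by g h \<in> H"
    and big: "\<And>V. \<lbrakk>subgroup V G; H \<subseteq> V; V \<noteq> H; \<And>v x. \<lbrakk>v \<in> V; x \<in> H\<rbrakk> \<Longrightarrow> conj_by v x \<in> H\<rbrakk> \<Longrightarrow> TI_subgroup V G"
    and TI: "TI_subgroup (normalizer G L) G"
  shows "malnormal (normalizer G L) G"
proof -
  define F where "F = normalizer G L"
  note LG [simp] = subgroup.mem_carrier[OF L(1)]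
  note Ls = subgroup.subset[OF L(1)]
  have F: "subgroup F G"
    unfolding F_def using Ls by (rule normalizer_imp_subgroup)
  note FG [simp] = subgroup.mem_carrier[OF F]
  note Fs = subgroup.subset[OF F]
  have finL: "finite L" and finF: "finite F" and finH: "finite H"
    using fin Ls Fs subgroup.subset[OF H] finite_subset by blast+
  have LF: "L \<subseteq> F"
    unfolding F_def using L(1) finL by (rule subgroup_subset_normalizer)
  have F_L: "conj_by f l \<in> L \<longleftrightarrow> l \<in> L" if "f \<in> F" "l \<in> carrier G" for f l
    using that conj_by_normalizer_mem_iff[OF Ls] by (simp add: F_def)
  have norm_F: "m \<in> F" if m: "m \<in> normalizer G F" for m
  proof (rule ccontr)
    assume "m \<notin> F"
    have mG: "m \<in> carrier G"
      using m Fs by (simp add: mem_normalizer_iff)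
    have m_F: "conj_by m f \<in> F \<longleftrightarrow> f \<in> F" if "f \<in> carrier G" for f
      using that m conj_by_normalizer_mem_iff[OF Fs] by simp
    have disj: "l = \<one>" if "l \<in> L" "conj_by m l \<in> L" for l
      using TI_subgroupD[OF L(3) mG that(1) _ that(2) finL] \<open>m \<notin> F\<close> by (auto simp: F_def)
    define M where "M = conj_set G L m"
    have M: "subgroup M G"
      unfolding M_def using L(1) mG by (rule subgroup_conj_set)
    note MG [simp] = subgroup.mem_carrier[OF M]
    have M_iff: "x \<in> M \<longleftrightarrow> (\<exists>l\<in>L. x = conj_by m l)" for x
      by (auto simp: M_def conj_set_eq)
    have MF: "M \<subseteq> F"
      using LF m_F by (auto simp: M_iff subset_iff)
    have M_normal: "conj_by f k \<in> M" if f: "f \<in> F" and k: "k \<in> M" for f k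
    proof -
      obtain l where l: "l \<in> L" "k = conj_by m l"
        using k by (auto simp: M_iff)
      define f' where "f' = conj_by (inv m) f"
      have f': "f' \<in> F"
        using m_F[of f'] f mG by (simp add: f'_def)
      have "conj_by f k = conj_by m (conj_by f' l)"
        using f mG l by (simp add: f'_def conj_by_def inv_mult_group m_assoc)
      then show ?thesis
        using F_L f' l by (auto simp: M_iff)
    qed
    have trivial: "x = \<one>" if "x \<in> L" "x \<in> M" for x
      using that disj mG by (metis M_iff conj_by_one)
    have comm: "k \<otimes> l = l \<otimes> k" if k: "k \<in> M" and l: "l \<in> L" for k l
    proof -
      have kF: "k \<in> F" and lF: "l \<in> F"
        using k l MF LF by auto
      \<comment> \<open>This element is a commutator of \<open>k\<close> and \<open>l\<close>; it
        lies in \<open>M\<close> and in \<open>L\<close>, both of which are normal in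
        \<open>F\<close>.\<close>
      have "inv k \<otimes> conj_by l k \<in> M"
        using k lF M M_normal by (simp add: subgroup.m_closed subgroup.m_inv_closed)
      moreover have "inv k \<otimes> conj_by l k = inv (conj_by k l) \<otimes> l"
        using k l by (simp add: conj_by_def inv_mult_group m_assoc)
      moreover have "inv (conj_by k l) \<otimes> l \<in> L"
        using kF l L(1) F_L by (simp add: subgroup.m_closed subgroup.m_inv_closed)
      ultimately have "inv k \<otimes> conj_by l k = \<one>"
        using trivial by simp
      then have "conj_by l k = k"
        using k l by (metis MG LG conj_by_closed inv_mult_cancel(2) r_one)
      then show ?thesis
        using conj_by_fixed_iff[of l k] k l by simp
    qed
    have HL: "x \<in> L" if "x \<in> H" for x
      using that L(2) by blast
    have conj_M: "conj_by k x = x" if "k \<in> M" "x \<in> H" for k x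
      using that by (metis MG LG HL comm conj_by_fixed_iff)
    define V where "V = H <#> M"
    have V: "subgroup V G"
      unfolding V_def using H M conj_M by (intro subgroup_set_mult) auto
    have HV: "H \<subseteq> V" and MV: "M \<subseteq> V"
      unfolding V_def using set_mult_superset[OF H M] by auto
    have "TI_subgroup V G"
    proof (rule big[OF V HV])
      obtain l where l: "l \<in> L" "l \<noteq> \<one>"
        using L(4) subgroup.one_closed[OF L(1)] by blast
      have "conj_by m l \<in> M"
        using l(1) M_iff by blast
      then have "conj_by m l \<in> V" "conj_by m l \<notin> H"
        using l MV disj HL by blast+
      then show "V \<noteq> H" by blast
    next
      fix v x assume v: "v \<in> V" and x: "x \<in> H"
      obtain y k where yk: "y \<in> H" "k \<in> M" "v = y \<otimes> k"
        using v by (auto simp: V_def set_mult_def)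
      then show "conj_by v x \<in> H"
        using x H HL conj_M by (simp add: mult_conj_by subgroup_conj_by)
    qed
    moreover have "finite V"
      using fin subgroup.subset[OF V] finite_subset by blast
    moreover have gG: "g \<in> carrier G"
      using g(1) Ls by (simp add: mem_normalizer_iff)
    ultimately have "g \<in> normalizer G V"
      using TI_subgroupD[of V g h] h HV by blast
    have "conj_by g x \<in> H" if x: "x \<in> H" for x
    proof -
      have "conj_by g x \<in> V"
        using conj_by_normalizer_mem_iff[OF subgroup.subset[OF V] \<open>g \<in> normalizer G V\<close>, of x] x HV HL by auto
      then obtain y k where yk: "y \<in> H" "k \<in> M" "conj_by g x = y \<otimes> k"
        by (auto simp: V_def set_mult_def)
      have "y \<otimes> k \<in> L"
        using g(1) F_L[of g x] x HL yk(3) by (simp add: F_def)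
      then have "inv y \<otimes> (y \<otimes> k) \<in> L"
        using yk(1) HL L(1) by (simp add: subgroup.m_closed subgroup.m_inv_closed)
      then have "k \<in> L"
        using yk HL by simp
      then have "k = \<one>"
        using trivial yk(2) by blast
      then show ?thesis
        using yk HL by simp
    qed
    then have "g \<in> normalizer G H"
      using gG finH subgroup.subset[OF H] by (intro mem_normalizerI)
    then show False
      using g(2) by blast
  qed
  \<comment> \<open>TI alone places \<open>k\<close> only in the normalizer of \<open>F\<close>;
    that \<open>F\<close> is self-normalizing does the rest.\<close>
  have "k \<in> F" if "k \<in> carrier G" "f \<in> F" "f \<noteq> \<one>" "conj_by k f \<in> F" for k f
    using norm_F TI_subgroupD[OF TI, of k f] that finF by (simp add: F_def)
  then show ?thesis
    unfolding F_def[symmetric] malnormal_iff using F by blast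
qed

text \<open>For the final contradiction, \<open>K\<close> is the conjugate of \<open>H\<close> by
  \<open>g\<close>. As \<open>g\<close> does not normalize \<open>H\<close>, there is a
  \<open>q\<close>-element \<open>w\<close> of \<open>K\<close> outside \<open>H\<close>. It is
  comparable with \<open>c\<close>, and either direction places \<open>c\<close> in
  \<open>K\<close>, which is impossible.\<close>

lemma counterexample_not_maximal:
  assumes fin: "finite (carrier G)" and p: "Factorial_Ring.prime p"
    and hyp: "\<And>V. \<lbrakk>self_centralizing V G; p dvd card V\<rbrakk> \<Longrightarrow> TI_subgroup V G \<or> subnormal V G"
    and H: "subgroup H G" "p dvd card H" "\<not> TI_subgroup H G" "\<not> subnormal H G"
    and max: "\<And>V. \<lbrakk>subgroup V G; H \<subset> V\<rbrakk> \<Longrightarrow> TI_subgroup V G \<or> subnormal V G"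
  shows False
proof -
  note HG [simp] = subgroup.mem_carrier[OF H(1)]
  note Hs = subgroup.subset[OF H(1)]
  have finH: "finite H"
    using fin Hs finite_subset by blast
  \<comment> \<open>\<open>H\<close> is normal in such a \<open>V\<close>, so subnormality of
    \<open>V\<close> would descend to \<open>H\<close>; maximality leaves TI.\<close>
  have big: "\<not> subnormal V G \<and> TI_subgroup V G"
    if V: "subgroup V G" "H \<subseteq> V" "V \<noteq> H" "\<And>v x. \<lbrakk>v \<in> V; x \<in> H\<rbrakk> \<Longrightarrow> conj_by v x \<in> H" for V
  proof -
    have "H \<lhd> G\<lparr>carrier := V\<rparr>"
      using H(1) V by (intro normal_in_subgroupI)
    then have "\<not> subnormal V G"
      using subnormal.step[OF _ H(1) V(2)] H(4) by blast
    then show ?thesis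
      using max[of V] V by blast
  qed
  obtain g h where g: "g \<in> carrier G" "g \<notin> normalizer G H" and h: "h \<in> H" "h \<noteq> \<one>" "conj_by g h \<in> H"
    using H(1,3) TI_subgroupI by blast
  have "\<not> self_centralizing H G"
    using hyp H by blast
  then have "\<not> centralizer G H \<subseteq> H"
    using H(1) by (simp add: self_centralizing_def)
  then obtain c q a where c: "c \<in> centralizer G H" "c \<notin> H" "Factorial_Ring.prime q" "ord c = q ^ a" "c [^] q \<in> H"
    using exists_prime_power_element_outside[OF fin H(1) subgroup_centralizer[OF Hs]] by blast
  have cG [simp]: "c \<in> carrier G" and c_H: "\<And>x. x \<in> H \<Longrightarrow> c \<otimes> x = x \<otimes> c"
    using c(1) by (auto simp: centralizer_def)
  define C where "C = generate G {c}"
  have C: "subgroup C G"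
    unfolding C_def by (intro generate_is_subgroup) simp
  have C_iff: "x \<in> C \<longleftrightarrow> (\<exists>i::nat. x = c [^] i)" for x
    using generate_pow_on_finite_carrier[OF fin cG] by (auto simp: C_def)
  have pow_H: "c [^] i \<otimes> x = x \<otimes> c [^] i" if "x \<in> H" for x and i :: nat
    using that c_H group_commutes_pow[of c x i] by simp
  define L where "L = H <#> C"
  have conj_C: "conj_by k x = x" if "k \<in> C" "x \<in> H" for k x
    using that pow_H conj_by_fixed_iff[of k x] by (auto simp: C_iff)
  have L: "subgroup L G"
    unfolding L_def using H(1) C conj_C by (intro subgroup_set_mult) auto
  note LG [simp] = subgroup.mem_carrier[OF L]
  note Ls = subgroup.subset[OF L]
  have HL: "H \<subseteq> L" and CL: "C \<subseteq> L"
    unfolding L_def using set_mult_superset[OF H(1) C] by auto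
  have L_iff: "x \<in> L \<longleftrightarrow> (\<exists>y\<in>H. \<exists>i::nat. x = y \<otimes> c [^] i)" for x
    by (auto simp: L_def set_mult_def) (metis C_iff)+
  have cC: "c \<in> C"
    by (simp add: C_def generate.incl)
  then have cL: "c \<in> L"
    using CL by blast
  have c_ne: "c \<noteq> \<one>"
    using c(2) subgroup.one_closed[OF H(1)] by blast
  have c_L: "c \<otimes> l = l \<otimes> c" if l: "l \<in> L" for l
  proof -
    obtain y and i :: nat where y: "y \<in> H" "l = y \<otimes> c [^] i"
      using l by (auto simp: L_iff)
    have "c \<otimes> l = y \<otimes> (c \<otimes> c [^] i)"
      using y c_H by (simp flip: m_assoc)
    also have "c \<otimes> c [^] i = c [^] i \<otimes> c"
      using group_commutes_pow[of c c i] by simp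
    finally show ?thesis
      using y by (simp add: m_assoc)
  qed
  have H_L: "conj_by l x \<in> H" if l: "l \<in> L" and x: "x \<in> H" for l x
  proof -
    obtain y k where "y \<in> H" "k \<in> C" "l = y \<otimes> k"
      using l by (auto simp: L_def set_mult_def)
    then show ?thesis
      using x H(1) conj_C subgroup.mem_carrier[OF C] by (simp add: mult_conj_by subgroup_conj_by)
  qed
  have L_TI: "\<not> subnormal L G" "TI_subgroup L G"
    using big[OF L HL _ H_L] cL c(2) by blast+
  have finL: "finite L"
    using fin Ls finite_subset by blast
  define F where "F = normalizer G L"
  have gF: "g \<in> F"
    unfolding F_def using TI_subgroupD[OF L_TI(2) g(1), of h] h HL finL by blast
  have F: "subgroup F G"
    unfolding F_def using Ls by (rule normalizer_imp_subgroup)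
  have LF: "L \<subseteq> F"
    unfolding F_def using L finL by (rule subgroup_subset_normalizer)
  have F_L: "conj_by f l \<in> L" if "f \<in> F" "l \<in> L" for f l
    using that conj_by_normalizer_mem_iff[OF Ls, of f l] by (simp add: F_def)
  have "L \<lhd> G\<lparr>carrier := F\<rparr>"
    using L F LF F_L by (intro normal_in_subgroupI)
  then have F_not_subnormal: "\<not> subnormal F G"
    using subnormal.step[OF _ L LF] L_TI(1) by blast
  then have "TI_subgroup F G"
    using max[OF F] HL LF cL c(2) by blast
  then have mal: "malnormal F G"
    unfolding F_def
    using L_TI(2) L HL cL c_ne gF g(2) h big fin H(1)
    by (intro malnormal_normalizer_TI[of H L g h]) (auto simp: F_def)
  have proper: "F \<noteq> carrier G"
    using F_not_subnormal subnormal.top by metis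
  obtain x where x: "x \<in> H" "x \<noteq> \<one>" "x [^] p = \<one>"
    using exists_prime_order_subgroup[OF fin p H(1,2)] by blast
  \<comment> \<open>The centre of \<open>L\<close> is invariant under \<open>F\<close>, contains
    \<open>c\<close> and centralizes \<open>x\<close>: it is the set \<open>A\<close> required for
    solubility.\<close>
  define Z where "Z = {z \<in> L. \<forall>l\<in>L. z \<otimes> l = l \<otimes> z}"
  have Z_F: "conj_by f z \<in> Z" if f: "f \<in> F" and z: "z \<in> Z" for f z
  proof -
    have fG: "f \<in> carrier G" and zL: "z \<in> L"
      using f z subgroup.mem_carrier[OF F] by (auto simp: Z_def)
    have "conj_by f z \<otimes> l = l \<otimes> conj_by f z" if l: "l \<in> L" for l
    proof -
      have "conj_by (inv f) l \<in> L"
        using F_L f l F by (simp add: subgroup.m_inv_closed)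
      then have "conj_by f (z \<otimes> conj_by (inv f) l) = conj_by f (conj_by (inv f) l \<otimes> z)"
        using z by (simp add: Z_def)
      then show ?thesis
        using fG zL l by (simp add: conj_by_mult)
    qed
    then show ?thesis
      using F_L f zL by (simp add: Z_def)
  qed
  have cZ: "c \<in> Z"
    using cL c_L by (simp add: Z_def)
  have hypo: "hypoabelian F G"
  proof (rule malnormal_hypoabelian[OF fin mal proper p hyp _ x(2,3) cZ c_ne _ Z_F])
    show "x \<in> F" "Z \<subseteq> F"
      using x(1) HL LF by (auto simp: Z_def)
    show "z \<otimes> x = x \<otimes> z" if "z \<in> Z" for z
      using that x(1) HL by (auto simp: Z_def)
  qed
  have comparable: "v \<in> generate G {u}"
    if "u \<in> F" "v \<in> F" "v \<otimes> u = u \<otimes> v" "ord u = q ^ i" "ord v = q ^ j" "j \<le> i" for u v i j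
    using commuting_prime_power_elements_comparable[OF fin c(3) F _ that(1,4,2,5,3,6)]
      malnormal_no_elementary_abelian[OF fin mal hypo proper c(3)] by blast
  define c' where "c' = conj_by g c"
  have c'_C: "c' \<in> C"
    \<comment> \<open>\<open>c\<close> is central in \<open>L\<close> and \<open>g\<close>
      normalizes \<open>L\<close>, so \<open>c\<close> and \<open>c'\<close> commute; having equal
      order they generate the same subgroup.\<close>
    unfolding C_def
  proof (rule comparable)
    show "c \<in> F" "c' \<in> F" "c' \<otimes> c = c \<otimes> c'"
      using cL LF F_L[OF gF cL] c_L by (auto simp: c'_def)
    show "ord c = q ^ a" "ord c' = q ^ a"
      using c(4) g(1) by (simp_all add: c'_def ord_conj_by)
  qed simp
  define K where "K = conj_set G H g"
  have K: "subgroup K G"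
    unfolding K_def using H(1) g(1) by (rule subgroup_conj_set)
  \<comment> \<open>Otherwise \<open>K\<close> contains \<open>c'\<close>, a power of
    \<open>c\<close>, and undoing the conjugation by \<open>g\<close> puts \<open>c\<close> into
    \<open>H\<close>.\<close>
  have c_K: "c \<notin> K"
  proof
    assume "c \<in> K"
    then have "C \<subseteq> K"
      unfolding C_def using K by (intro generate_subgroup_incl) auto
    then have "c' \<in> K"
      using c'_C by blast
    then show False
      using c(2) g(1) Hs mem_conj_set_iff[of g H c'] by (simp add: K_def c'_def)
  qed
  have pow_c: "c \<in> V" if "subgroup V G" "c [^] i \<in> V" "c [^] (q ^ n) \<in> V" "\<not> q dvd i" for V and i n :: nat
    using that c(3) pow_mem_subgroup_coprime[OF that(1) cG, of "q ^ n" i] by (simp add: prime_imp_coprime)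
  obtain y0 where y0: "y0 \<in> H" "conj_by g y0 \<notin> H"
    using g finH Hs mem_normalizerI[of H g] by blast
  define y where "y = conj_by g y0"
  have yK: "y \<in> K"
    using y0(1) by (simp add: K_def y_def conj_set_eq)
  have yL: "y \<in> L"
    using y0(1) HL F_L[OF gF] by (auto simp: y_def)
  have yG [simp]: "y \<in> carrier G"
    using yL by simp
  have "ord y \<noteq> 0"
    using ord_ge_1[OF fin yG] by simp
  then obtain m where m: "ord y = q ^ multiplicity q (ord y) * m" "\<not> q dvd m"
    using multiplicity_decompose'[of "ord y" q] c(3) by (metis not_prime_unit)
  define b where "b = multiplicity q (ord y)"
  \<comment> \<open>Raising to the part \<open>m\<close> of the order prime to \<open>q\<close>
    leaves a \<open>q\<close>-element, while \<open>y\<close> stays recoverable modulo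
    \<open>H\<close>: \<open>L\<close> modulo \<open>H\<close> has order \<open>q\<close>.\<close>
  define w where "w = y [^] m"
  have ord_w: "ord w = q ^ b"
  proof -
    have "m dvd ord y" "m \<noteq> 0"
      using m by (metis dvd_triv_right, metis dvd_0_right)
    then have "ord w = ord y div m"
      unfolding w_def by (intro ord_pow) auto
    then show ?thesis
      using m(1) \<open>m \<noteq> 0\<close> b_def by (metis nonzero_mult_div_cancel_right)
  qed
  have w: "w \<in> K" "w \<in> L"
    using yK yL K L by (simp_all add: w_def subgroup_nat_pow_closed)
  have "w \<notin> H"
  proof
    assume wH: "w \<in> H"
    obtain t and i :: nat where t: "t \<in> H" "y = t \<otimes> c [^] i"
      using yL by (auto simp: L_iff)
    have "w = t [^] m \<otimes> c [^] (i * m)"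
      unfolding w_def t(2) using t(1) pow_H pow_mult_distrib[of t "c [^] i" m] by (simp add: nat_pow_pow)
    then have "c [^] (i * m) = inv (t [^] m) \<otimes> w"
      using t(1) by simp
    also have "\<dots> \<in> H"
      using wH t(1) H(1) by (simp add: subgroup.m_closed subgroup.m_inv_closed subgroup_nat_pow_closed)
    finally have im: "c [^] (i * m) \<in> H" .
    show False
    proof (cases "q dvd i")
      case True
      then obtain d where "i = q * d" by blast
      then have "c [^] i \<in> H"
        using c(5) H(1) by (metis cG nat_pow_pow subgroup_nat_pow_closed)
      then have "y \<in> H"
        using t H(1) by (simp add: subgroup.m_closed)
      then show False
        using y0(2) by (simp add: y_def)
    next
      case False
      then have "\<not> q dvd i * m"
        using m(2) c(3) prime_dvd_mult_iff by blast
      then show False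
        using pow_c[OF H(1) im, of 1] c(2,5) by simp
    qed
  qed
  have wF: "w \<in> F" and cF: "c \<in> F" and comm: "w \<otimes> c = c \<otimes> w"
    using w(2) cL LF c_L by auto
  show False
  proof (cases "b \<le> a")
    case True
    then have "w \<in> C"
      unfolding C_def using comparable[OF cF wF comm c(4) ord_w] by blast
    then obtain j :: nat where j: "w = c [^] j"
      by (auto simp: C_iff)
    \<comment> \<open>Since \<open>c [^] q\<close> is in \<open>H\<close> and \<open>w\<close> is
      not, \<open>j\<close> is prime to \<open>q\<close>, so \<open>w\<close> and \<open>c\<close>
      generate the same subgroup.\<close>
    have "\<not> q dvd j"
    proof
      assume "q dvd j"
      then obtain d where "j = q * d" by blast
      then have "w \<in> H"
        using c(5) H(1) j by (metis cG nat_pow_pow subgroup_nat_pow_closed)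
      then show False
        using \<open>w \<notin> H\<close> by blast
    qed
    moreover have "c [^] (q ^ a) \<in> K"
      using c(4) pow_ord_eq_1[OF cG] subgroup.one_closed[OF K] by simp
    ultimately show False
      using pow_c[OF K, of j a] w(1) j c_K by simp
  next
    case False
    then have "c \<in> generate G {w}"
      using comparable[OF wF cF comm[symmetric] ord_w c(4)] by simp
    moreover have "generate G {w} \<subseteq> K"
      using w(1) K by (intro generate_subgroup_incl) auto
    ultimately show False
      using c_K by blast
  qed
qed

end

section \<open>Reduction to a counterexample of largest order\<close>

theorem theorem1p5:
  fixes G :: "('a, 'b) monoid_scheme" and p :: nat
  assumes "group G" and "finite (carrier G)"
    and "Factorial_Ring.prime p" and "p dvd order G"
  shows "(\<forall>H. self_centralizing H G \<longrightarrow>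
              TI_subgroup H G \<or> subnormal H G \<or> \<not> p dvd card H)
         \<longleftrightarrow>
         (\<forall>H. subgroup H G \<longrightarrow>
              TI_subgroup H G \<or> subnormal H G \<or> \<not> p dvd card H)"
    (is "?self \<longleftrightarrow> ?all")
proof
  interpret group G by fact
  assume self: ?self
  define bad where "bad H \<longleftrightarrow> subgroup H G \<and> p dvd card H \<and> \<not> TI_subgroup H G \<and> \<not> subnormal H G" for H
  have card_le: "card H \<le> card (carrier G)" if "bad H" for H
    using that assms(2) by (auto simp: bad_def intro: card_mono dest: subgroup.subset)
  have "\<not> bad H" for H
  proof
    assume "bad H"
    then obtain K where K: "bad K" and max: "\<And>V. bad V \<Longrightarrow> card V \<le> card K"
      using ex_has_greatest_nat[of bad H card "Suc (card (carrier G))"] card_le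
      by (auto simp: less_Suc_eq_le)
    \<comment> \<open>By Lagrange \<open>p\<close> also divides the order of every overgroup, so an
      overgroup violating the conclusion would be a larger counterexample.\<close>
    have "TI_subgroup V G \<or> subnormal V G" if V: "subgroup V G" "K \<subset> V" for V
    proof -
      have "finite V"
        using V(1) assms(2) by (meson finite_subset subgroup.subset)
      then have "card K < card V"
        using V(2) by (rule psubset_card_mono)
      moreover have "p dvd card V"
      proof -
        interpret V: group "G\<lparr>carrier := V\<rparr>"
          using V(1) by (rule subgroup_imp_group)
        have "subgroup K (G\<lparr>carrier := V\<rparr>)"
          using K V by (auto simp: bad_def intro: subgroup_incl)
        then have "card (rcosets\<^bsub>G\<lparr>carrier := V\<rparr>\<^esub> K) * card K = card V"
          using V.lagrange[of K] by (simp add: order_def)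
        then show ?thesis
          using K by (metis bad_def dvd_mult)
      qed
      ultimately show ?thesis
        using max[of V] V(1) by (auto simp: bad_def)
    qed
    then show False
      using counterexample_not_maximal[OF assms(2,3), of K] K self by (auto simp: bad_def)
  qed
  then show ?all
    by (auto simp: bad_def)
qed (auto simp: self_centralizing_def)

end
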